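(* With the \textsc{Balanced Like} mechanism, restricted to instances with $n=2$ agents and general (rational non-negative) utilities, the problems \textsc{ExactUtility} and \textsc{NecessaryUtility} are both solvable in polynomial time. Here \textsc{ExactUtility} is the problem: given an instance $\mathcal{I}=(A,O,U,o)$ with fixed arrival ordering $o$ and an agent $a_i\in A$, output $u_{im}(o)$; and \textsc{NecessaryUtility} is the problem: given such $\mathcal{I}$, $a_i$ and a number $k\in\mathbb{Q}$, decide whether $u_{im}(o)\ge k$.
   Context: Instances. An instance $\mathcal{I}=(A,O,U,o)$ consists of a set $A=\{a_1,\dots,a_n\}$ of agents, a set $O=\{o_1,\dots,o_m\}$ of indivisible items, rational non-negative utilities $u_{ik}$ of agent $a_i$ for item $o_k$ (collected in $U$), and a known ordering $o$ of the $m$ items in which they arrive one at a time. Agents bid sincerely, i.e. agent $a_i$ bids $v_{ik}=u_{ik}$ for item $o_k$. Utilities are additive. \textsc{Balanced Like} mechanism. Each arriving item is allocated immediately and irrevocably. Agent $a_i$ is feasible for arriving item $o_k$ if $v_{ik}>0$ and $a_i$ has so far received the fewest items among all agents who bid positively for $o_k$. The item is given to one of the feasible agents chosen uniformly at random; if no agent bids positively for it, nobody receives it. Expected utility. $u_{im}(o)=\sum_{\pi}p(\pi)\,u_i(\pi)$, where $\pi$ ranges over the allocations of the $m$ items that the mechanism can produce when they arrive in the order $o$, $p(\pi)$ is the probability of $\pi$, and $u_i(\pi)$ is the sum of the utilities of $a_i$ for the items it receives in $\pi$. *)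

theory Defs
  imports
    "HOL-Probability.Probability_Mass_Function"
    "HOL-Computational_Algebra.Polynomial"
    "HOL-Library.Log_Nat"
begin

section \<open>Instances and the Balanced Like mechanism\<close>

text \<open>Agents are \<open>0, \<dots>, num_agents - 1\<close> and items are \<open>0, \<dots>, num_items - 1\<close>;
  \<open>utility I i k\<close> is meaningful only for indices in these ranges.\<close>

record alloc_inst =
  num_agents :: nat
  num_items :: nat
  utility :: "nat \<Rightarrow> nat \<Rightarrow> rat"
  arrival :: "nat list"

definition valid_inst :: "alloc_inst \<Rightarrow> bool" where
  "valid_inst I \<longleftrightarrow>
     (\<forall>i < num_agents I. \<forall>k < num_items I. utility I i k \<ge> 0) \<and>
     distinct (arrival I) \<and> set (arrival I) = {..<num_items I}"

text \<open>An allocation maps each item to the agent who received it, if any.\<close>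

type_synonym allocation = "nat \<Rightarrow> nat option"

definition received :: "allocation \<Rightarrow> nat \<Rightarrow> nat set" where
  "received \<pi> i = {k. \<pi> k = Some i}"

definition bidders :: "nat \<Rightarrow> (nat \<Rightarrow> nat \<Rightarrow> rat) \<Rightarrow> nat \<Rightarrow> nat set" where
  "bidders n v k = {i. i < n \<and> v i k > 0}"

definition feasible :: "nat \<Rightarrow> (nat \<Rightarrow> nat \<Rightarrow> rat) \<Rightarrow> allocation \<Rightarrow> nat \<Rightarrow> nat set" where
  "feasible n v \<pi> k =
     {i \<in> bidders n v k. \<forall>j \<in> bidders n v k. card (received \<pi> i) \<le> card (received \<pi> j)}"

definition allocate_item ::
    "nat \<Rightarrow> (nat \<Rightarrow> nat \<Rightarrow> rat) \<Rightarrow> allocation \<Rightarrow> nat \<Rightarrow> allocation pmf" where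
  "allocate_item n v \<pi> k =
     (if bidders n v k = {} then return_pmf \<pi>
      else map_pmf (\<lambda>i. \<pi>(k \<mapsto> i)) (pmf_of_set (feasible n v \<pi> k)))"

primrec allocate_items ::
    "nat \<Rightarrow> (nat \<Rightarrow> nat \<Rightarrow> rat) \<Rightarrow> nat list \<Rightarrow> allocation \<Rightarrow> allocation pmf" where
  "allocate_items n v [] \<pi> = return_pmf \<pi>"
| "allocate_items n v (k # ks) \<pi> =
     bind_pmf (allocate_item n v \<pi> k) (allocate_items n v ks)"

text \<open>Bidding is sincere: the bids are the utilities.\<close>

definition balanced_like :: "alloc_inst \<Rightarrow> allocation pmf" where
  "balanced_like I = allocate_items (num_agents I) (utility I) (arrival I) Map.empty"

definition alloc_utility :: "alloc_inst \<Rightarrow> nat \<Rightarrow> allocation \<Rightarrow> rat" where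
  "alloc_utility I i \<pi> = (\<Sum>k \<in> received \<pi> i. utility I i k)"

definition expected_utility :: "alloc_inst \<Rightarrow> nat \<Rightarrow> real" where
  "expected_utility I i =
     (\<Sum>\<pi> \<in> set_pmf (balanced_like I).
        pmf (balanced_like I) \<pi> * real_of_rat (alloc_utility I i \<pi>))"

lemma finite_set_pmf_allocate_items: "finite (set_pmf (allocate_items n v ks \<pi>))"
proof (induction ks arbitrary: \<pi>)
  case Nil
  show ?case by simp
next
  case (Cons k ks)
  have "finite (set_pmf (allocate_item n v \<pi> k))"
  proof (cases "bidders n v k = {}")
    case True
    then show ?thesis by (simp add: allocate_item_def)
  next
    case False
    have fin: "finite (bidders n v k)" by (simp add: bidders_def)
    obtain i where "i \<in> bidders n v k"
      "\<forall>j \<in> bidders n v k. card (received \<pi> i) \<le> card (received \<pi> j)"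
      using ex_min_if_finite[of "(\<lambda>i. card (received \<pi> i)) ` bidders n v k"] fin False
      by (force simp: not_less)
    then have "feasible n v \<pi> k \<noteq> {}" by (auto simp: feasible_def)
    moreover have "finite (feasible n v \<pi> k)"
      using fin by (simp add: feasible_def)
    ultimately show ?thesis using False by (simp add: allocate_item_def)
  qed
  with Cons show ?case by simp
qed

text \<open>So the sum defining \<open>expected_utility\<close> is a genuine finite sum.\<close>

lemma finite_set_pmf_balanced_like: "finite (set_pmf (balanced_like I))"
  by (simp add: balanced_like_def finite_set_pmf_allocate_items)


section \<open>Random access machines with logarithmic cost\<close>

text \<open>Polynomial time is measured on a random access machine whose registers hold integers,
  under the logarithmic cost criterion of Aho, Hopcroft and Ullman: an instruction is charged the
  bit lengths of all register addresses and register contents that it accesses. Multiplication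
  and division do not add power, since the length of a result is at most the cost charged, and
  the model is polynomially equivalent to Turing machines.\<close>

datatype instr =
    SetC nat int
  | Add nat nat nat
  | Sub nat nat nat
  | Mul nat nat nat
  | Div nat nat nat
  | Load nat nat
  | Store nat nat
  | Jump nat
  | JumpPos nat nat

type_synonym memory = "nat \<Rightarrow> int"

text \<open>A sign bit followed by the binary digits of the absolute value.\<close>

definition bit_len :: "int \<Rightarrow> nat" where
  "bit_len z = 1 + floorlog 2 (nat \<bar>z\<bar>)"

text \<open>The first operand of an arithmetic instruction and of \<open>Load\<close> is the target register;
  \<open>Store a b\<close> writes register \<open>b\<close> to the register addressed by register \<open>a\<close>. Negative addresses
  are read as address 0, division rounds down, and division by 0 yields 0.\<close>

fun step :: "instr \<Rightarrow> nat \<times> memory \<Rightarrow> nat \<times> memory" where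
  "step (SetC d z) (pc, s) = (pc + 1, s(d := z))"
| "step (Add d a b) (pc, s) = (pc + 1, s(d := s a + s b))"
| "step (Sub d a b) (pc, s) = (pc + 1, s(d := s a - s b))"
| "step (Mul d a b) (pc, s) = (pc + 1, s(d := s a * s b))"
| "step (Div d a b) (pc, s) = (pc + 1, s(d := s a div s b))"
| "step (Load d a) (pc, s) = (pc + 1, s(d := s (nat (s a))))"
| "step (Store a b) (pc, s) = (pc + 1, s(nat (s a) := s b))"
| "step (Jump l) (pc, s) = (l, s)"
| "step (JumpPos a l) (pc, s) = (if s a > 0 then l else pc + 1, s)"

abbreviation addr_len :: "nat \<Rightarrow> nat" where
  "addr_len a \<equiv> bit_len (int a)"

fun cost :: "instr \<Rightarrow> memory \<Rightarrow> nat" where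
  "cost (SetC d z) s = addr_len d + bit_len z"
| "cost (Add d a b) s = addr_len d + addr_len a + addr_len b + bit_len (s a) + bit_len (s b)"
| "cost (Sub d a b) s = addr_len d + addr_len a + addr_len b + bit_len (s a) + bit_len (s b)"
| "cost (Mul d a b) s = addr_len d + addr_len a + addr_len b + bit_len (s a) + bit_len (s b)"
| "cost (Div d a b) s = addr_len d + addr_len a + addr_len b + bit_len (s a) + bit_len (s b)"
| "cost (Load d a) s = addr_len d + addr_len a + bit_len (s a) + bit_len (s (nat (s a)))"
| "cost (Store a b) s = addr_len a + bit_len (s a) + addr_len b + bit_len (s b)"
| "cost (Jump l) s = 1"
| "cost (JumpPos a l) s = addr_len a + bit_len (s a)"

text \<open>\<open>runs P pc s t s'\<close>: started at instruction \<open>pc\<close> with memory \<open>s\<close>, the program \<open>P\<close> halts, by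
  leaving the program text, with memory \<open>s'\<close> after total cost \<open>t\<close>.\<close>

inductive runs :: "instr list \<Rightarrow> nat \<Rightarrow> memory \<Rightarrow> nat \<Rightarrow> memory \<Rightarrow> bool" for P where
  halt: "pc \<ge> length P \<Longrightarrow> runs P pc s 0 s"
| step: "pc < length P \<Longrightarrow> step (P ! pc) (pc, s) = (pc', s') \<Longrightarrow> runs P pc' s' t s''
           \<Longrightarrow> runs P pc s (cost (P ! pc) s + t) s''"

definition init_memory :: "int list \<Rightarrow> memory" where
  "init_memory xs j = (if j < length xs then xs ! j else 0)"

definition has_output :: "memory \<Rightarrow> int list \<Rightarrow> bool" where
  "has_output s ys \<longleftrightarrow> (\<forall>j < length ys. s j = ys ! j)"

definition input_size :: "int list \<Rightarrow> nat" where
  "input_size xs = (\<Sum>x \<leftarrow> xs. bit_len x)"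

text \<open>A problem is a set \<open>D\<close> of inputs with a relation \<open>R x y\<close> stating that \<open>y\<close> is a correct
  answer for \<open>x\<close>.\<close>

definition poly_time_solvable ::
    "('a \<Rightarrow> int list) \<Rightarrow> ('b \<Rightarrow> int list) \<Rightarrow> 'a set \<Rightarrow> ('a \<Rightarrow> 'b \<Rightarrow> bool) \<Rightarrow> bool" where
  "poly_time_solvable enc_in enc_out D R \<longleftrightarrow>
     (\<exists>(P :: instr list) (p :: nat poly). \<forall>x \<in> D. \<exists>y t s.
        runs P 0 (init_memory (enc_in x)) t s \<and>
        t \<le> poly p (input_size (enc_in x)) \<and>
        has_output s (enc_out y) \<and> R x y)"


section \<open>Encodings and the two problems\<close>

text \<open>Rationals are numerator and denominator in lowest terms.\<close>

definition enc_rat :: "rat \<Rightarrow> int list" where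
  "enc_rat q = [fst (quotient_of q), snd (quotient_of q)]"

definition enc_bool :: "bool \<Rightarrow> int list" where
  "enc_bool b = [of_bool b]"

definition enc_inst :: "alloc_inst \<Rightarrow> int list" where
  "enc_inst I =
     [int (num_agents I), int (num_items I)] @
     concat (map (\<lambda>i. concat (map (\<lambda>k. enc_rat (utility I i k)) [0..<num_items I]))
       [0..<num_agents I]) @
     map int (arrival I)"

definition enc_exact :: "alloc_inst \<times> nat \<Rightarrow> int list" where
  "enc_exact = (\<lambda>(I, i). enc_inst I @ [int i])"

definition enc_necessary :: "alloc_inst \<times> nat \<times> rat \<Rightarrow> int list" where
  "enc_necessary = (\<lambda>(I, i, k). enc_inst I @ [int i] @ enc_rat k)"

definition exact_utility :: "alloc_inst \<times> nat \<Rightarrow> rat \<Rightarrow> bool" where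
  "exact_utility = (\<lambda>(I, i) q. real_of_rat q = expected_utility I i)"

definition necessary_utility :: "alloc_inst \<times> nat \<times> rat \<Rightarrow> bool \<Rightarrow> bool" where
  "necessary_utility = (\<lambda>(I, i, k) b. b \<longleftrightarrow> expected_utility I i \<ge> real_of_rat k)"

end

theory Submission
  imports Defs
begin

text \<open>With two agents the mechanism depends on the past only through the lead of an agent, the
  number of items it has received minus the number the other agent has received. The coin is tossed
  only at lead 0, after which the lead is 1 or -1, and every later item keeps the possible leads
  within a pair \<open>c, c + 2\<close>: an item bid for by one agent shifts both, and an item bid for by both
  moves every nonzero lead towards 0. So the distribution of the lead is described by \<open>c\<close> and two
  weights with sum \<open>2 ^ t\<close> after \<open>t\<close> items, and one pass over the items accumulates the expected
  utility as a fraction whose numerator and denominator have polynomially many bits. Euclid's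
  algorithm brings it to lowest terms; the decision problem only compares two fractions.

  The pass is a program for the random access machine. In a loop-free program every bit length grows
  by at most a constant factor, so a polynomial bound on the bit lengths at each loop head and on
  the number of iterations bounds the total cost.\<close>

section \<open>Structured programs\<close>

text \<open>The coin tosses for \<open>m\<close> items have up to \<open>2 ^ m\<close> outcomes; the
  branches can be merged because they recombine. The critical pairs of leads are those around 0:
  from \<open>0, 2\<close> a toss leads to -1 or 1 while 2 also falls to 1; \<open>-2, 0\<close> is
  the mirror image; and from \<open>-1, 1\<close> both leads return to 0, recorded as the pair
  \<open>0, 2\<close> with second weight 0. All weights are doubled at every item, tossed for or
  not, so that a toss halves them exactly and only integers occur.

  The fraction is never reduced inside the pass. Its denominator is \<open>2 ^ t\<close> times the
  product of the input denominators seen so far, hence short enough; and running Euclid's algorithm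
  at every item would nest loops, while \<open>while_terminates\<close> asks for a loop-free body.
  The constant-factor growth of such a body would be exponential if compounded over the rounds, so
  the bound at the loop head has to come from the meaning of the registers: \<open>dp_bounds\<close>
  limits each component of the state in terms of the input size and the number of items
  seen.\<close>

datatype com = Block "instr list" | Seq com com | IfPos nat com com | WhilePos nat com

fun jump_free :: "instr \<Rightarrow> bool" where
  "jump_free (Jump l) = False"
| "jump_free (JumpPos a l) = False"
| "jump_free _ = True"

definition effect :: "instr \<Rightarrow> memory \<Rightarrow> memory" where
  "effect i s = snd (step i (0, s))"

lemma effect_simps [simp]:
  "effect (SetC d z) s = s(d := z)"
  "effect (Add d a b) s = s(d := s a + s b)"
  "effect (Sub d a b) s = s(d := s a - s b)"
  "effect (Mul d a b) s = s(d := s a * s b)"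
  "effect (Div d a b) s = s(d := s a div s b)"
  "effect (Load d a) s = s(d := s (nat (s a)))"
  "effect (Store a b) s = s(nat (s a) := s b)"
  by (simp_all add: effect_def)

lemma step_jump_free: "jump_free i \<Longrightarrow> step i (pc, s) = (pc + 1, effect i s)"
  by (cases i) simp_all

primrec effects :: "instr list \<Rightarrow> memory \<Rightarrow> memory" where
  "effects [] s = s"
| "effects (i # is) s = effects is (effect i s)"

primrec block_cost :: "instr list \<Rightarrow> memory \<Rightarrow> nat" where
  "block_cost [] s = 0"
| "block_cost (i # is) s = cost i s + block_cost is (effect i s)"

text \<open>The costs are those of the compiled code: each extra 1 pays for a plain
  \<open>Jump\<close> placed by \<open>compile\<close>, over the other branch, out of the loop or
  back to its test. The target 0 in \<open>JumpPos r 0\<close> is a placeholder, as the cost does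
  not depend on it.\<close>

inductive exec :: "com \<Rightarrow> memory \<Rightarrow> nat \<Rightarrow> memory \<Rightarrow> bool" where
  Block: "list_all jump_free is \<Longrightarrow> exec (Block is) s (block_cost is s) (effects is s)"
| Seq: "exec c s t s' \<Longrightarrow> exec d s' t' s'' \<Longrightarrow> exec (Seq c d) s (t + t') s''"
| IfTrue: "s r > 0 \<Longrightarrow> exec c s t s' \<Longrightarrow>
    exec (IfPos r c d) s (cost (JumpPos r 0) s + t) s'"
| IfFalse: "\<not> s r > 0 \<Longrightarrow> exec d s t s' \<Longrightarrow>
    exec (IfPos r c d) s (cost (JumpPos r 0) s + t + 1) s'"
| WhileFalse: "\<not> s r > 0 \<Longrightarrow> exec (WhilePos r c) s (cost (JumpPos r 0) s + 1) s"
| WhileTrue: "s r > 0 \<Longrightarrow> exec c s t s' \<Longrightarrow> exec (WhilePos r c) s' t' s'' \<Longrightarrow>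
    exec (WhilePos r c) s (cost (JumpPos r 0) s + t + 1 + t') s''"

primrec code_length :: "com \<Rightarrow> nat" where
  "code_length (Block is) = length is"
| "code_length (Seq c d) = code_length c + code_length d"
| "code_length (IfPos r c d) = code_length c + code_length d + 2"
| "code_length (WhilePos r c) = code_length c + 3"

text \<open>\<open>compile c l\<close> is the code of \<open>c\<close> placed at address \<open>l\<close>; jump targets are absolute.\<close>

primrec compile :: "com \<Rightarrow> nat \<Rightarrow> instr list" where
  "compile (Block is) l = is"
| "compile (Seq c d) l = compile c l @ compile d (l + code_length c)"
| "compile (IfPos r c d) l =
     JumpPos r (l + 2 + code_length d) # compile d (l + 1) @
     Jump (l + 2 + code_length d + code_length c) # compile c (l + 2 + code_length d)"
| "compile (WhilePos r c) l =
     [JumpPos r (l + 2), Jump (l + 3 + code_length c)] @ compile c (l + 2) @ [Jump l]"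

lemma length_compile [simp]: "length (compile c l) = code_length c"
  by (induction c arbitrary: l) simp_all

definition code_at :: "instr list \<Rightarrow> nat \<Rightarrow> instr list \<Rightarrow> bool" where
  "code_at P l is \<longleftrightarrow> (\<forall>j < length is. l + j < length P \<and> P ! (l + j) = is ! j)"

lemma code_at_Nil [simp]: "code_at P l []"
  by (simp add: code_at_def)

lemma code_at_Cons [simp]:
  "code_at P l (i # is) \<longleftrightarrow> l < length P \<and> P ! l = i \<and> code_at P (l + 1) is"
  by (auto simp: code_at_def nth_Cons less_Suc_eq_0_disj split: nat.splits)

lemma code_at_append [simp]:
  "code_at P l (is @ js) \<longleftrightarrow> code_at P l is \<and> code_at P (l + length is) js"
  by (induction "is" arbitrary: l) (auto simp: algebra_simps)

lemma code_at_self: "code_at P 0 P"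
  by (simp add: code_at_def)

lemma runs_step:
  assumes "pc < length P" "P ! pc = i" "step i (pc, s) = (pc', s')" "runs P pc' s' t s''"
    "t' = cost i s + t"
  shows "runs P pc s t' s''"
  using assms runs.step[of pc P s pc' s' t s''] by auto

lemma runs_block:
  assumes "list_all jump_free is" "code_at P l is" "runs P (l + length is) (effects is s) t s''"
  shows "runs P l s (block_cost is s + t) s''"
  using assms
proof (induction "is" arbitrary: l s)
  case Nil
  then show ?case by simp
next
  case (Cons i "is")
  have "runs P (l + 1) (effect i s) (block_cost is (effect i s) + t) s''"
    using Cons.prems by (intro Cons.IH) auto
  then show ?case
    using Cons.prems by - (rule runs_step[of l P i s "l + 1" "effect i s"],
       auto simp: step_jump_free)
qed

text \<open>Since \<open>runs\<close> describes complete runs up to halting, code is composed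
  backwards: a halting run from the end of the code of \<open>c\<close> is prolonged to one from its
  start. No notion of a partial run is needed.\<close>

lemma exec_runs:
  assumes "exec c s t s'" "code_at P l (compile c l)"
    "runs P (l + code_length c) s' u s''"
  shows "runs P l s (t + u) s''"
  using assms
proof (induction arbitrary: l u s'' rule: exec.induct)
  case (Block "is" s)
  then show ?case by (auto intro: runs_block)
next
  case (Seq c s t s' d t' s1)
  have "runs P (l + code_length c) s' (t' + u) s''"
    using Seq.prems by (intro Seq.IH) (auto simp: add.assoc)
  then have "runs P l s (t + (t' + u)) s''"
    using Seq.prems by (intro Seq.IH(1)) auto
  then show ?case by (simp add: algebra_simps)
next
  case (IfTrue s r c t s' d)
  have "runs P (l + 2 + code_length d) s (t + u) s''"
    using IfTrue.prems by (intro IfTrue.IH) (auto simp: algebra_simps)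
  then show ?case
    using IfTrue.prems IfTrue.hyps
    by - (rule runs_step[of l P "JumpPos r (l + 2 + code_length d)" s], auto)
next
  case (IfFalse s r d t s' c)
  have "runs P (l + 1 + code_length d) s' (1 + u) s''"
    using IfFalse.prems by - (rule runs_step[where pc' = "l + 2 + code_length d + code_length c"
        and t = u and i = "Jump (l + 2 + code_length d + code_length c)"],
       auto simp: algebra_simps)
  then have "runs P (l + 1) s (t + (1 + u)) s''"
    using IfFalse.prems by (intro IfFalse.IH) (auto simp: algebra_simps)
  then show ?case
    using IfFalse.prems IfFalse.hyps
    by - (rule runs_step[of l P "JumpPos r (l + 2 + code_length d)" s], auto)
next
  case (WhileFalse s r c)
  have "runs P (l + 1) s (1 + u) s''"
    using WhileFalse.prems
    by - (rule runs_step[where pc' = "l + 3 + code_length c" and t = u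
        and i = "Jump (l + 3 + code_length c)"], auto simp: algebra_simps)
  then show ?case
    using WhileFalse.prems WhileFalse.hyps
    by - (rule runs_step[of l P "JumpPos r (l + 2)" s], auto)
next
  case (WhileTrue s r c t s' t' s1)
  have "runs P l s' (t' + u) s''"
    using WhileTrue.prems by (intro WhileTrue.IH) auto
  then have "runs P (l + 2 + code_length c) s' (1 + (t' + u)) s''"
    using WhileTrue.prems
    by - (rule runs_step[where pc' = l and t = "t' + u" and i = "Jump l"],
       auto simp: algebra_simps)
  then have "runs P (l + 2) s (t + (1 + (t' + u))) s''"
    using WhileTrue.prems by (intro WhileTrue.IH) (auto simp: algebra_simps)
  then show ?case
    using WhileTrue.prems WhileTrue.hyps
    by - (rule runs_step[of l P "JumpPos r (l + 2)" s], auto)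
qed

lemma poly_time_solvableI:
  assumes "\<And>x. x \<in> D \<Longrightarrow> \<exists>y t s. exec c (init_memory (enc_in x)) t s \<and>
    t \<le> K * (input_size (enc_in x) + 1) ^ e \<and> has_output s (enc_out y) \<and> R x y"
  shows "poly_time_solvable enc_in enc_out D R"
  unfolding poly_time_solvable_def
proof (rule exI[of _ "compile c 0"], rule exI[of _ "smult K ([:1, 1:] ^ e)"], rule ballI)
  fix x assume "x \<in> D"
  then obtain y t s where *: "exec c (init_memory (enc_in x)) t s"
    "t \<le> K * (input_size (enc_in x) + 1) ^ e" "has_output s (enc_out y)" "R x y"
    using assms by blast
  have "runs (compile c 0) 0 (init_memory (enc_in x)) t s"
    using exec_runs[OF *(1), of "compile c 0" 0 0 s] by (simp add: code_at_self halt)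
  moreover have "t \<le> poly (smult K ([:1, 1:] ^ e)) (input_size (enc_in x))"
    using *(2) by (simp add: poly_power add.commute)
  ultimately show "\<exists>y t s. runs (compile c 0) 0 (init_memory (enc_in x)) t s \<and>
      t \<le> poly (smult K ([:1, 1:] ^ e)) (input_size (enc_in x)) \<and>
      has_output s (enc_out y) \<and> R x y"
    using *(3,4) by blast
qed

section \<open>Bit lengths\<close>

lemma bit_len_le_iff: "bit_len z \<le> e + 1 \<longleftrightarrow> \<bar>z\<bar> < 2 ^ e"
  by (simp add: bit_len_def floorlog_le_iff nat_less_iff)

lemma bit_len_pos: "bit_len z \<ge> 1"
  by (simp add: bit_len_def)

lemma abs_less_bit_len: "\<bar>z\<bar> < 2 ^ (bit_len z - 1)"
  using bit_len_le_iff[of z "bit_len z - 1"] bit_len_pos[of z] by simp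

lemma bit_len_mono: "\<bar>x\<bar> \<le> \<bar>y\<bar> \<Longrightarrow> bit_len x \<le> bit_len y"
  by (simp add: bit_len_def floorlog_mono nat_mono)

lemma bit_len_uminus [simp]: "bit_len (- z) = bit_len z"
  by (simp add: bit_len_def)

text \<open>Wasteful for sums, but of the same shape as the bound for products, so that every
  arithmetic instruction at most doubles the largest bit length.\<close>

lemma bit_len_add: "bit_len (x + y) \<le> bit_len x + bit_len y"
proof -
  define p q where "p = bit_len x - 1" and "q = bit_len y - 1"
  have "\<bar>x\<bar> + 1 \<le> 2 ^ p" "\<bar>y\<bar> + 1 \<le> 2 ^ q"
    using abs_less_bit_len[of x] abs_less_bit_len[of y] by (simp_all add: p_def q_def)
  \<comment> \<open>Expanding the product gives \<open>|x| + |y| + 1\<close> plus a nonnegative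
    term.\<close>
  then have "(\<bar>x\<bar> + 1) * (\<bar>y\<bar> + 1) \<le> 2 ^ p * 2 ^ q"
    by (intro mult_mono) auto
  moreover have "0 \<le> \<bar>x\<bar> * \<bar>y\<bar>" by simp
  ultimately have "\<bar>x + y\<bar> < 2 ^ (p + q)"
    using abs_triangle_ineq[of x y] unfolding power_add distrib_left distrib_right by linarith
  then have "bit_len (x + y) \<le> p + q + 1" unfolding bit_len_le_iff .
  then show ?thesis
    using bit_len_pos[of x] bit_len_pos[of y] by (simp add: p_def q_def)
qed

lemma bit_len_diff: "bit_len (x - y) \<le> bit_len x + bit_len y"
  using bit_len_add[of x "- y"] by simp

lemma bit_len_mult: "bit_len (x * y) \<le> bit_len x + bit_len y"
proof -
  define p q where "p = bit_len x - 1" and "q = bit_len y - 1"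
  have "\<bar>x\<bar> < 2 ^ p" "\<bar>y\<bar> < 2 ^ q"
    using abs_less_bit_len[of x] abs_less_bit_len[of y] by (simp_all add: p_def q_def)
  then have "\<bar>x * y\<bar> < 2 ^ (p + q)"
    unfolding abs_mult power_add by (intro mult_strict_mono') auto
  then have "bit_len (x * y) \<le> p + q + 1" unfolding bit_len_le_iff .
  then show ?thesis
    using bit_len_pos[of x] bit_len_pos[of y] by (simp add: p_def q_def)
qed

lemma abs_div_le: "\<bar>x div y\<bar> \<le> \<bar>x :: int\<bar>"
proof (cases "y = 0")
  case False
  \<comment> \<open>Positive divisors suffice, because negating dividend and divisor preserves the
    quotient. For negative \<open>x\<close> the rounding goes away from 0, but the quotient stays
    between \<open>x\<close> and -1.\<close>
  have "\<bar>x div y\<bar> \<le> \<bar>x\<bar>" if "y > 0" for x y :: int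
  proof (cases "x \<ge> 0")
    case True
    then show ?thesis using that
      by (metis abs_of_nonneg div_by_1 int_one_le_iff_zero_less pos_imp_zdiv_nonneg_iff
          zdiv_mono2 zero_less_one)
  next
    case neg: False
    have "x div 1 \<le> x div y"
      using neg that by (intro zdiv_mono2_neg) auto
    moreover have "x div y < 0"
      using neg that by (simp add: neg_imp_zdiv_neg_iff not_le pos_imp_zdiv_neg_iff)
    ultimately show ?thesis by simp
  qed
  from this[of y x] this[of "- y" "- x"] False show ?thesis
    by (cases "y > 0") auto
qed simp

lemma bit_len_div: "bit_len (x div y) \<le> bit_len x"
  by (intro bit_len_mono abs_div_le)

lemma bit_len_le_power: "\<bar>z\<bar> \<le> 2 ^ e \<Longrightarrow> bit_len z \<le> e + 2"
  using bit_len_le_iff[of z "e + 1"] by (simp add: le_less_trans[of _ "2 ^ e"])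

text \<open>Crude, but enough for addresses and counters, which are at most linear in the input
  length.\<close>

lemma bit_len_le_linear: "\<bar>z\<bar> \<le> int k \<Longrightarrow> bit_len z \<le> k + 2"
proof -
  assume "\<bar>z\<bar> \<le> int k"
  also have "int k \<le> 2 ^ k"
    by (metis less_exp less_imp_le of_nat_le_iff of_nat_numeral of_nat_power)
  finally show ?thesis by (rule bit_len_le_power)
qed

lemma bit_len_leI: "- int k \<le> z \<Longrightarrow> z \<le> int k \<Longrightarrow> k + 2 \<le> M \<Longrightarrow> bit_len z \<le> M"
  using bit_len_le_linear[of z k] by linarith

section \<open>Bounding the cost of structured programs\<close>

text \<open>All registers are covered, not just those named in a program, because a
  \<open>Load\<close> may read any of them.\<close>

definition bounded_mem :: "nat \<Rightarrow> memory \<Rightarrow> bool" where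
  "bounded_mem M s \<longleftrightarrow> (\<forall>j. bit_len (s j) \<le> M)"

lemma bounded_memD: "bounded_mem M s \<Longrightarrow> bit_len (s j) \<le> M"
  by (simp add: bounded_mem_def)

lemma bounded_mem_pos: "bounded_mem M s \<Longrightarrow> M \<ge> 1"
  using bit_len_pos[of "s 0"] bounded_memD[of M s 0] by (meson order.trans)

lemma bounded_mem_mono: "bounded_mem M s \<Longrightarrow> M \<le> M' \<Longrightarrow> bounded_mem M' s"
  unfolding bounded_mem_def using order.trans by blast

lemma bounded_mem_upd: "bounded_mem M s \<Longrightarrow> bit_len v \<le> M \<Longrightarrow> bounded_mem M (s(r := v))"
  by (simp add: bounded_mem_def)

fun loop_free :: "com \<Rightarrow> bool" where
  "loop_free (Block is) = list_all jump_free is"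
| "loop_free (Seq c d) \<longleftrightarrow> loop_free c \<and> loop_free d"
| "loop_free (IfPos r c d) \<longleftrightarrow> loop_free c \<and> loop_free d"
| "loop_free (WhilePos r c) = False"

text \<open>Loop-free programs act as functions on memories, which \<open>simp\<close> can evaluate.
  The clause for loops is a dummy.\<close>

primrec denote :: "com \<Rightarrow> memory \<Rightarrow> memory" where
  "denote (Block is) s = effects is s"
| "denote (Seq c d) s = denote d (denote c s)"
| "denote (IfPos r c d) s = (if s r > 0 then denote c s else denote d s)"
| "denote (WhilePos r c) s = s"

definition terminates :: "com \<Rightarrow> memory \<Rightarrow> nat \<Rightarrow> (memory \<Rightarrow> bool) \<Rightarrow> bool" where
  "terminates c s T Q \<longleftrightarrow> (\<exists>t s'. exec c s t s' \<and> t \<le> T \<and> Q s')"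

lemma terminates_Seq:
  assumes "terminates c s T Q" "\<And>s'. Q s' \<Longrightarrow> terminates d s' T' R"
  shows "terminates (Seq c d) s (T + T') R"
proof -
  obtain t s' where c: "exec c s t s'" "t \<le> T" "Q s'" using assms(1) by (auto simp: terminates_def)
  obtain t' s'' where d: "exec d s' t' s''" "t' \<le> T'" "R s''"
    using assms(2)[OF c(3)] by (auto simp: terminates_def)
  show ?thesis
    unfolding terminates_def using exec.Seq[OF c(1) d(1)] add_mono[OF c(2) d(2)] d(3) by blast
qed

lemma terminates_weaken:
  assumes "terminates c s T Q" "T \<le> T'" "\<And>s'. Q s' \<Longrightarrow> R s'"
  shows "terminates c s T' R"
proof -
  obtain t s' where "exec c s t s'" "t \<le> T" "Q s'" using assms(1) by (auto simp: terminates_def)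
  then show ?thesis using assms(2,3) le_trans unfolding terminates_def by blast
qed

lemma instr_bound:
  assumes "jump_free i"
  shows "\<exists>K. \<forall>M s. bounded_mem M s \<longrightarrow> cost i s \<le> K * M \<and> bounded_mem (K * M) (effect i s)"
proof -
  \<comment> \<open>\<open>A\<close> is the part of the cost fixed by the text of the instruction;
    the list holds the at most two register contents that are charged on top.\<close>
  obtain A where A: "\<And>s :: memory. cost i s \<le> A + (\<Sum>r \<leftarrow> (case i of
      SetC d z \<Rightarrow> [] | Add d a b \<Rightarrow> [s a, s b] | Sub d a b \<Rightarrow> [s a, s b]
    | Mul d a b \<Rightarrow> [s a, s b] | Div d a b \<Rightarrow> [s a, s b] | Load d a \<Rightarrow> [s a, s (nat (s a))]
    | Store a b \<Rightarrow> [s a, s b] | _ \<Rightarrow> []). bit_len r)"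
  proof (cases i)
    case (SetC d z) then show ?thesis using that[of "addr_len d + bit_len z"] by simp
  next
    case (Add d a b) then show ?thesis using that[of "addr_len d + addr_len a + addr_len b"] by simp
  next
    case (Sub d a b) then show ?thesis using that[of "addr_len d + addr_len a + addr_len b"] by simp
  next
    case (Mul d a b) then show ?thesis using that[of "addr_len d + addr_len a + addr_len b"] by simp
  next
    case (Div d a b) then show ?thesis using that[of "addr_len d + addr_len a + addr_len b"] by simp
  next
    case (Load d a) then show ?thesis using that[of "addr_len d + addr_len a"] by simp
  next
    case (Store a b) then show ?thesis using that[of "addr_len a + addr_len b"] by simp
  qed (use assms in auto)
  obtain Z where Z: "\<And>d z. i = SetC d z \<Longrightarrow> bit_len z \<le> Z"
    by (cases i) auto
  define K where "K = A + Z + 2"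
  show ?thesis
  proof (rule exI[of _ K], intro allI impI conjI)
    fix M s assume bd: "bounded_mem M s"
    have M: "M \<ge> 1" and le: "\<And>j. bit_len (s j) \<le> M"
      using bounded_mem_pos[OF bd] bounded_memD[OF bd] by auto
    have le2: "bit_len (s a) + bit_len (s b) \<le> 2 * M" for a b
      using le[of a] le[of b] by simp
    have "(\<Sum>r \<leftarrow> (case i of
      SetC d z \<Rightarrow> [] | Add d a b \<Rightarrow> [s a, s b] | Sub d a b \<Rightarrow> [s a, s b]
    | Mul d a b \<Rightarrow> [s a, s b] | Div d a b \<Rightarrow> [s a, s b] | Load d a \<Rightarrow> [s a, s (nat (s a))]
    | Store a b \<Rightarrow> [s a, s b] | _ \<Rightarrow> []). bit_len r) \<le> 2 * M"
      using le2 by (cases i) simp_all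
    with A[of s] have "cost i s \<le> A + 2 * M" by linarith
    moreover have AM: "A \<le> A * M" "Z \<le> Z * M"
      using mult_left_mono[OF M, of A] mult_left_mono[OF M, of Z] by simp_all
    ultimately show "cost i s \<le> K * M" unfolding K_def distrib_right by linarith
    have KM: "2 * M \<le> K * M" unfolding K_def by (intro mult_right_mono) auto
    have upd: "bounded_mem (K * M) (s(r := v))" if "bit_len v \<le> 2 * M \<or> bit_len v \<le> Z" for r v
    proof (rule bounded_mem_upd)
      show "bounded_mem (K * M) s" by (rule bounded_mem_mono[OF bd]) (simp add: K_def)
      show "bit_len v \<le> K * M" using that KM AM unfolding K_def distrib_right by linarith
    qed
    have ops: "bit_len (s a + s b) \<le> 2 * M" "bit_len (s a - s b) \<le> 2 * M"
      "bit_len (s a * s b) \<le> 2 * M" "bit_len (s a div s b) \<le> 2 * M" "bit_len (s a) \<le> 2 * M"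
      for a b
      using le2[of a b] bit_len_add[of "s a" "s b"] bit_len_diff[of "s a" "s b"]
        bit_len_mult[of "s a" "s b"] bit_len_div[of "s a" "s b"] le[of a] by linarith+
    show "bounded_mem (K * M) (effect i s)"
      using assms by (cases i) (auto intro!: upd simp: ops Z)
  qed
qed

lemma block_bound:
  assumes "list_all jump_free is"
  shows "\<exists>K. \<forall>M s. bounded_mem M s \<longrightarrow>
    block_cost is s \<le> K * M \<and> bounded_mem (K * M) (effects is s)"
  using assms
proof (induction "is")
  case Nil
  then show ?case by (intro exI[of _ 1]) simp
next
  case (Cons i "is")
  then obtain K where K: "\<And>M s. bounded_mem M s \<Longrightarrow>
    block_cost is s \<le> K * M \<and> bounded_mem (K * M) (effects is s)" by auto
  obtain L where L: "\<And>M s. bounded_mem M s \<Longrightarrow> cost i s \<le> L * M \<and> bounded_mem (L * M) (effect i s)"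
    using instr_bound[of i] Cons.prems by auto
  show ?case
  proof (intro exI allI impI)
    fix M s assume bd: "bounded_mem M s"
    have "bounded_mem (L * M) (effect i s)" "cost i s \<le> L * M" using L[OF bd] by auto
    with K[of "L * M" "effect i s"]
    have "block_cost (i # is) s \<le> (L + K * L) * M"
      and "bounded_mem (K * (L * M)) (effects (i # is) s)"
      by (auto simp: algebra_simps)
    then show "block_cost (i # is) s \<le> (L + K * L) * M \<and>
        bounded_mem ((L + K * L) * M) (effects (i # is) s)"
      by (auto simp: algebra_simps intro: bounded_mem_mono)
  qed
qed

lemma loop_free_bound:
  assumes "loop_free c"
  shows "\<exists>K. \<forall>M s. bounded_mem M s \<longrightarrow>
    (\<exists>t. exec c s t (denote c s) \<and> t \<le> K * M) \<and> bounded_mem (K * M) (denote c s)"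
  using assms
proof (induction c)
  case (Block "is")
  then have jf: "list_all jump_free is" by simp
  then obtain K where K: "\<And>M s. bounded_mem M s \<Longrightarrow>
      block_cost is s \<le> K * M \<and> bounded_mem (K * M) (effects is s)"
    using block_bound by blast
  show ?case
  proof (rule exI[of _ K], intro allI impI conjI)
    fix M s assume bd: "bounded_mem M s"
    show "\<exists>t. exec (Block is) s t (denote (Block is) s) \<and> t \<le> K * M"
      using exec.Block[OF jf, of s] K[OF bd] by auto
    show "bounded_mem (K * M) (denote (Block is) s)" using K[OF bd] by simp
  qed
next
  case (Seq c d)
  then obtain K L where K: "\<And>M s. bounded_mem M s \<Longrightarrow>
      (\<exists>t. exec c s t (denote c s) \<and> t \<le> K * M) \<and> bounded_mem (K * M) (denote c s)"
    and L: "\<And>M s. bounded_mem M s \<Longrightarrow>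
      (\<exists>t. exec d s t (denote d s) \<and> t \<le> L * M) \<and> bounded_mem (L * M) (denote d s)"
    unfolding loop_free.simps(2) by meson
  show ?case
  proof (intro exI allI impI)
    fix M s assume bd: "bounded_mem M s"
    obtain t where t: "exec c s t (denote c s)" "t \<le> K * M" "bounded_mem (K * M) (denote c s)"
      using K[OF bd] by auto
    obtain u where u: "exec d (denote c s) u (denote d (denote c s))" "u \<le> L * (K * M)"
      "bounded_mem (L * (K * M)) (denote d (denote c s))"
      using L[OF t(3)] by auto
    have "exec (Seq c d) s (t + u) (denote (Seq c d) s)"
      using t u exec.Seq by auto
    moreover have "t + u \<le> (K + L * K) * M" using t u by (simp add: algebra_simps)
    moreover have "bounded_mem ((K + L * K) * M) (denote (Seq c d) s)"
      using u by (auto simp: algebra_simps intro: bounded_mem_mono)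
    ultimately show "(\<exists>t. exec (Seq c d) s t (denote (Seq c d) s) \<and> t \<le> (K + L * K) * M) \<and>
        bounded_mem ((K + L * K) * M) (denote (Seq c d) s)" by blast
  qed
next
  case (IfPos r c d)
  then obtain K L where K: "\<And>M s. bounded_mem M s \<Longrightarrow>
      (\<exists>t. exec c s t (denote c s) \<and> t \<le> K * M) \<and> bounded_mem (K * M) (denote c s)"
    and L: "\<And>M s. bounded_mem M s \<Longrightarrow>
      (\<exists>t. exec d s t (denote d s) \<and> t \<le> L * M) \<and> bounded_mem (L * M) (denote d s)"
    unfolding loop_free.simps(3) by meson
  show ?case
  proof (intro exI allI impI)
    fix M s assume bd: "bounded_mem M s"
    let ?C = "addr_len r + 2 + K + L"
    have M: "M \<ge> 1" using bd by (rule bounded_mem_pos)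
    have jump: "cost (JumpPos r 0) s + 1 \<le> (addr_len r + 2) * M"
    proof -
      have "addr_len r * 1 \<le> addr_len r * M" using M by (rule mult_left_mono) simp
      with M bounded_memD[OF bd, of r] show ?thesis unfolding cost.simps distrib_right by linarith
    qed
    show "(\<exists>t. exec (IfPos r c d) s t (denote (IfPos r c d) s) \<and> t \<le> ?C * M) \<and>
        bounded_mem (?C * M) (denote (IfPos r c d) s)"
    proof (cases "s r > 0")
      case True
      obtain t where t: "exec c s t (denote c s)" "t \<le> K * M" "bounded_mem (K * M) (denote c s)"
        using K[OF bd] by auto
      have "exec (IfPos r c d) s (cost (JumpPos r 0) s + t) (denote c s)"
        using True t(1) by (rule exec.IfTrue)
      moreover have "cost (JumpPos r 0) s + t \<le> ?C * M"
        using jump t(2) by (simp add: algebra_simps)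
      moreover have "bounded_mem (?C * M) (denote c s)"
        by (rule bounded_mem_mono[OF t(3)]) (simp add: algebra_simps)
      ultimately show ?thesis using True by auto
    next
      case False
      obtain t where t: "exec d s t (denote d s)" "t \<le> L * M" "bounded_mem (L * M) (denote d s)"
        using L[OF bd] by auto
      have "exec (IfPos r c d) s (cost (JumpPos r 0) s + t + 1) (denote d s)"
        using False t(1) by (rule exec.IfFalse)
      moreover have "cost (JumpPos r 0) s + t + 1 \<le> ?C * M"
        using jump t(2) by (simp add: algebra_simps)
      moreover have "bounded_mem (?C * M) (denote d s)"
        by (rule bounded_mem_mono[OF t(3)]) (simp add: algebra_simps)
      ultimately show ?thesis using False by auto
    qed
  qed
qed simp

text \<open>Only the existence of a factor independent of the memory matters; choosing one gives it
  a name that can enter the final polynomial.\<close>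

definition cost_const :: "com \<Rightarrow> nat" where
  "cost_const c = (SOME K. \<forall>M s. bounded_mem M s \<longrightarrow> (\<exists>t. exec c s t (denote c s) \<and> t \<le> K * M))"

lemma loop_free_exec:
  assumes "loop_free c" "bounded_mem M s"
  shows "\<exists>t. exec c s t (denote c s) \<and> t \<le> cost_const c * M"
proof -
  have "\<exists>K. \<forall>M s. bounded_mem M s \<longrightarrow> (\<exists>t. exec c s t (denote c s) \<and> t \<le> K * M)"
    using loop_free_bound[OF assms(1)] by blast
  from someI_ex[OF this] assms(2) show ?thesis unfolding cost_const_def by blast
qed

lemma loop_free_terminates:
  assumes "loop_free c" "bounded_mem M s" "Q (denote c s)"
  shows "terminates c s (cost_const c * M) Q"
  using loop_free_exec[OF assms(1,2)] assms(3) unfolding terminates_def by blast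

definition while_const :: "nat \<Rightarrow> com \<Rightarrow> nat" where
  "while_const r c = addr_len r + 2 + cost_const c"

text \<open>The invariant re-establishes the same bound \<open>M\<close> at every test, so each
  round costs at most \<open>while_const r c * M\<close>, and \<open>\<mu>\<close> limits the number
  of rounds. The added 1 pays for the final failing test.\<close>

lemma while_terminates:
  fixes \<mu> :: "memory \<Rightarrow> nat"
  assumes lf: "loop_free c" and "Inv s" and bd: "\<And>s. Inv s \<Longrightarrow> bounded_mem M s"
    and step: "\<And>s. Inv s \<Longrightarrow> s r > 0 \<Longrightarrow> Inv (denote c s)"
      "\<And>s. Inv s \<Longrightarrow> s r > 0 \<Longrightarrow> \<mu> (denote c s) < \<mu> s"
  shows "terminates (WhilePos r c) s (while_const r c * M * (\<mu> s + 1)) (\<lambda>s'. Inv s' \<and> \<not> s' r > 0)"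
proof -
  let ?C = "while_const r c"
  have jump: "cost (JumpPos r 0) s + 1 \<le> (addr_len r + 2) * M" if "Inv s" for s
  proof -
    have bd: "bounded_mem M s" by (rule bd[OF that])
    then have M: "M \<ge> 1" by (rule bounded_mem_pos)
    then have "addr_len r * 1 \<le> addr_len r * M" by (rule mult_left_mono) simp
    with M bounded_memD[OF bd, of r] show ?thesis unfolding cost.simps distrib_right by linarith
  qed
  show "terminates (WhilePos r c) s (?C * M * (\<mu> s + 1)) (\<lambda>s'. Inv s' \<and> \<not> s' r > 0)"
    using \<open>Inv s\<close>
  proof (induction "\<mu> s" arbitrary: s rule: less_induct)
    case less
    show ?case
    proof (cases "s r > 0")
      case True
      obtain t where t: "exec c s t (denote c s)" "t \<le> cost_const c * M"
        using loop_free_exec[OF lf bd[OF less.prems]] by blast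
      have st: "Inv (denote c s)" "\<mu> (denote c s) < \<mu> s"
        using step[OF less.prems True] by auto
      obtain u s' where u: "exec (WhilePos r c) (denote c s) u s'"
        "u \<le> ?C * M * (\<mu> (denote c s) + 1)" "Inv s'" "\<not> s' r > 0"
        using less.hyps[OF st(2) st(1)] by (auto simp: terminates_def)
      have "u \<le> ?C * M * \<mu> s"
        by (rule order.trans[OF u(2)], rule mult_left_mono) (use st(2) in simp_all)
      moreover have "cost (JumpPos r 0) s + t + 1 \<le> ?C * M"
        using jump[OF less.prems] t(2) by (simp add: while_const_def algebra_simps)
      ultimately have "cost (JumpPos r 0) s + t + 1 + u \<le> ?C * M * (\<mu> s + 1)"
        by (simp add: algebra_simps)
      then show ?thesis
        using exec.WhileTrue[of s r c, OF True t(1) u(1)] u unfolding terminates_def by blast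
    next
      case False
      have "cost (JumpPos r 0) s + 1 \<le> ?C * M"
        using jump[OF less.prems] by (simp add: while_const_def algebra_simps)
      also have "\<dots> \<le> ?C * M * (\<mu> s + 1)" by simp
      finally show ?thesis
        using exec.WhileFalse[of s r c, OF False] False less.prems unfolding terminates_def by blast
    qed
  qed
qed

section \<open>Expected utility by dynamic programming\<close>

text \<open>The expected utility still to come at lead \<open>d\<close>. Numerator and denominator
  of the agent's utility are kept apart, as in the registers; of the other agent's utility only the
  sign influences the allocation, so its numerator suffices.\<close>

fun future :: "(int \<times> int \<times> int) list \<Rightarrow> int \<Rightarrow> real" where
  "future [] d = 0"
| "future ((a, b, w) # xs) d =
    (if a > 0 then
       if w > 0 then
         if d < 0 then a / b + future xs (d + 1)
         else if d > 0 then future xs (d - 1)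
         else (a / b + future xs 1 + future xs (- 1)) / 2
       else a / b + future xs (d + 1)
     else if w > 0 then future xs (d - 1) else future xs d)"

definition item :: "(nat \<Rightarrow> nat \<Rightarrow> rat) \<Rightarrow> nat \<Rightarrow> nat \<Rightarrow> int \<times> int \<times> int" where
  "item v i k = (fst (quotient_of (v i k)), snd (quotient_of (v i k)),
     fst (quotient_of (v (1 - i) k)))"

lemma real_of_rat_quotient:
  "real_of_rat r = real_of_int (fst (quotient_of r)) / real_of_int (snd (quotient_of r))"
  using quotient_of_div[of r "fst (quotient_of r)" "snd (quotient_of r)"]
  by (metis of_rat_divide of_rat_of_int_eq prod.collapse)

lemma fst_quotient_of_pos_iff: "fst (quotient_of r) > 0 \<longleftrightarrow> r > 0"
proof -
  have "real_of_int (snd (quotient_of r)) > 0" using quotient_of_denom_pos' by simp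
  then have "fst (quotient_of r) > 0 \<longleftrightarrow> real_of_rat r > 0"
    unfolding real_of_rat_quotient by (simp add: zero_less_divide_iff)
  then show ?thesis by simp
qed

definition lead :: "allocation \<Rightarrow> nat \<Rightarrow> int" where
  "lead \<pi> i = int (card (received \<pi> i)) - int (card (received \<pi> (1 - i)))"

lemma received_upd:
  assumes "\<pi> k = None"
  shows "received (\<pi>(k \<mapsto> j)) i = (if i = j then insert k (received \<pi> i) else received \<pi> i)"
  using assms by (auto simp: received_def)

lemma finite_received: "finite (dom \<pi>) \<Longrightarrow> finite (received \<pi> i)"
  by (rule finite_subset[of _ "dom \<pi>"]) (auto simp: received_def)

lemma bidders_two:
  assumes "i < 2"
  shows "bidders 2 v k =
    (if v i k > 0 then {i} else {}) \<union> (if v (1 - i) k > 0 then {1 - i} else {})"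
proof -
  have "j < 2 \<longleftrightarrow> j = i \<or> j = 1 - i" for j using assms by auto
  then show ?thesis by (auto simp: bidders_def)
qed

lemma feasible_two:
  assumes "i < 2"
  shows "feasible 2 v \<pi> k =
    (if v i k > 0 then
       if v (1 - i) k > 0 then
         if lead \<pi> i < 0 then {i} else if lead \<pi> i > 0 then {1 - i} else {i, 1 - i}
       else {i}
     else if v (1 - i) k > 0 then {1 - i} else {})"
  unfolding feasible_def bidders_two[OF assms] by (auto simp: lead_def)

lemma expectation_bind_allocate_item:
  assumes "i < 2"
  shows "measure_pmf.expectation (allocate_items 2 v (k # ks) \<pi>) (h :: allocation \<Rightarrow> real) =
    (let E = (\<lambda>\<pi>. measure_pmf.expectation (allocate_items 2 v ks \<pi>) h) in
     if v i k > 0 then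
       if v (1 - i) k > 0 then
         if lead \<pi> i < 0 then E (\<pi>(k \<mapsto> i))
         else if lead \<pi> i > 0 then E (\<pi>(k \<mapsto> 1 - i))
         else (E (\<pi>(k \<mapsto> i)) + E (\<pi>(k \<mapsto> 1 - i))) / 2
       else E (\<pi>(k \<mapsto> i))
     else if v (1 - i) k > 0 then E (\<pi>(k \<mapsto> 1 - i)) else E \<pi>)"
proof -
  have ne: "i \<noteq> 1 - i" "1 - i \<noteq> i" using assms by arith+
  have coin: "measure_pmf.expectation (pmf_of_set {i, 1 - i} \<bind> (\<lambda>j. allocate_items 2 v ks (\<pi>(k \<mapsto> j)))) h
     = (measure_pmf.expectation (allocate_items 2 v ks (\<pi>(k \<mapsto> i))) h +
        measure_pmf.expectation (allocate_items 2 v ks (\<pi>(k \<mapsto> 1 - i))) h) / 2"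
    using ne by (subst pmf_expectation_bind_pmf_of_set)
      (auto simp: finite_set_pmf_allocate_items field_simps)
  show ?thesis
    unfolding allocate_items.simps allocate_item_def feasible_two[OF assms] bidders_two[OF assms]
    using coin by (auto simp: Let_def bind_return_pmf bind_map_pmf pmf_of_set_singleton)
qed

text \<open>As the remaining items are new, handing one out raises exactly one count by 1 and adds
  the utility of that item to its receiver's sum. So the past enters only through the utility
  already earned and the lead.\<close>

lemma expectation_allocate_items:
  assumes "i < 2" "finite (dom \<pi>)" "distinct ks" "set ks \<inter> dom \<pi> = {}"
  shows "measure_pmf.expectation (allocate_items 2 v ks \<pi>)
      (\<lambda>\<pi>'. real_of_rat (\<Sum>k\<in>received \<pi>' i. v i k)) =
    real_of_rat (\<Sum>k\<in>received \<pi> i. v i k) + future (map (item v i) ks) (lead \<pi> i)"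
  using assms(2-)
proof (induction ks arbitrary: \<pi>)
  case Nil
  then show ?case by simp
next
  case (Cons k ks)
  let ?u = "\<lambda>\<pi>. real_of_rat (\<Sum>k\<in>received \<pi> i. v i k)"
  have new: "\<pi> k = None" using Cons.prems by auto
  have notin: "k \<notin> received \<pi> j" for j using new by (simp add: received_def)
  have fin: "finite (received \<pi> j)" for j using Cons.prems by (simp add: finite_received)
  have ne: "1 - i \<noteq> i" using assms(1) by arith
  have own: "?u (\<pi>(k \<mapsto> i)) = ?u \<pi> + real_of_rat (v i k)" "lead (\<pi>(k \<mapsto> i)) i = lead \<pi> i + 1"
    and other: "?u (\<pi>(k \<mapsto> 1 - i)) = ?u \<pi>" "lead (\<pi>(k \<mapsto> 1 - i)) i = lead \<pi> i - 1"
    using new notin fin ne by (auto simp: received_upd lead_def of_rat_add)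
  have IH: "measure_pmf.expectation (allocate_items 2 v ks \<pi>') ?u =
      ?u \<pi>' + future (map (item v i) ks) (lead \<pi>' i)"
    if "\<pi>' = \<pi> \<or> \<pi>' = \<pi>(k \<mapsto> j)" for \<pi>' j
  proof -
    have sub: "dom \<pi>' \<subseteq> insert k (dom \<pi>)" using that by (auto split: if_splits)
    moreover have "finite (dom \<pi>')" using finite_subset[OF sub] Cons.prems by simp
    ultimately show ?thesis using Cons.prems by (intro Cons.IH) auto
  qed
  show ?case
    unfolding expectation_bind_allocate_item[OF assms(1)] Let_def
    by (simp add: IH[OF disjI1[OF refl]] IH[OF disjI2[OF refl]] own other item_def[of v i k]
        fst_quotient_of_pos_iff real_of_rat_quotient[of "v i k"] del: One_nat_def)
qed

lemma expected_utility_eq_future: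
  assumes "valid_inst I" "num_agents I = 2" "i < 2"
  shows "expected_utility I i = future (map (item (utility I) i) (arrival I)) 0"
proof -
  have "expected_utility I i = measure_pmf.expectation (balanced_like I)
      (\<lambda>\<pi>. real_of_rat (\<Sum>k\<in>received \<pi> i. utility I i k))"
    unfolding expected_utility_def alloc_utility_def
    by (subst integral_measure_pmf[OF finite_set_pmf_balanced_like]) auto
  also have "\<dots> = future (map (item (utility I) i) (arrival I)) 0"
    unfolding balanced_like_def assms(2)
    using assms expectation_allocate_items[of i Map.empty "arrival I" "utility I"]
    by (simp add: valid_inst_def received_def lead_def)
  finally show ?thesis .
qed

text \<open>The lead of the agent is \<open>c\<close> with weight \<open>p\<close> and \<open>c + 2\<close> with weight \<open>q\<close>; no other leads occur.
  The last component is the weight with which the agent receives the item, relative to the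
  new total weight.\<close>

definition move :: "int \<Rightarrow> int \<Rightarrow> int \<Rightarrow> int \<Rightarrow> int \<Rightarrow> int \<times> int \<times> int \<times> int" where
  "move a w c p q =
    (if a > 0 then
       if w > 0 then
         if c > 0 then (c - 1, 2 * p, 2 * q, 0)
         else if c = 0 then (- 1, p, p + 2 * q, p)
         else if c = - 1 then (0, 2 * (p + q), 0, 2 * p)
         else if c = - 2 then (- 1, 2 * p + q, q, 2 * p + q)
         else (c + 1, 2 * p, 2 * q, 2 * (p + q))
       else (c + 1, 2 * p, 2 * q, 2 * (p + q))
     else if w > 0 then (c - 1, 2 * p, 2 * q, 0) else (c, 2 * p, 2 * q, 0))"

section \<open>Integer state of the dynamic program: its value and its size\<close>

type_synonym dp_state = "int \<times> int \<times> int \<times> int \<times> int"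

text \<open>\<open>N\<close> is a numerator over \<open>(p + q) * B\<close>. The new denominator is
  \<open>2 * (p + q) * (b * B)\<close>, so the old numerator is multiplied by \<open>2 * b\<close>,
  and the gain \<open>a / b\<close>, of probability \<open>x / (2 * (p + q))\<close>, contributes
  \<open>a * x * B\<close>.\<close>

fun dp_step :: "int \<times> int \<times> int \<Rightarrow> dp_state \<Rightarrow> dp_state" where
  "dp_step (a, b, w) (c, p, q, B, N) =
    (case move a w c p q of (c', p', q', x) \<Rightarrow> (c', p', q', b * B, 2 * N * b + a * x * B))"

definition dp_init :: dp_state where
  "dp_init = (0, 1, 0, 1, 0)"

text \<open>A conserved quantity: what has been earned in expectation plus what is still to come. At
  \<open>dp_init\<close> it is the expectation sought, and when no items are left it is the computed
  fraction.\<close>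

fun dp_value :: "(int \<times> int \<times> int) list \<Rightarrow> dp_state \<Rightarrow> real" where
  "dp_value xs (c, p, q, B, N) =
     N / ((p + q) * B) + (p * future xs c + q * future xs (c + 2)) / (p + q)"

text \<open>The last exponent is a convenient one: the item after \<open>t\<close> others multiplies
  \<open>N\<close> by at most \<open>2 ^ (n + 1)\<close> and adds at most
  \<open>2 ^ ((n + 1) * (t + 1))\<close>. The bounds also make the denominators in
  \<open>dp_value\<close> positive.\<close>

fun dp_bounds :: "nat \<Rightarrow> nat \<Rightarrow> dp_state \<Rightarrow> bool" where
  "dp_bounds n t (c, p, q, B, N) \<longleftrightarrow>
     \<bar>c\<bar> \<le> int t \<and> 0 \<le> p \<and> 0 \<le> q \<and> p + q = 2 ^ t \<and> 0 < B \<and> B \<le> 2 ^ (n * t) \<and>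
     0 \<le> N \<and> N \<le> 2 ^ ((2 * n + 3) * t)"

definition item_ok :: "nat \<Rightarrow> int \<times> int \<times> int \<Rightarrow> bool" where
  "item_ok n = (\<lambda>(a, b, w). 0 \<le> a \<and> a \<le> 2 ^ n \<and> 0 < b \<and> b \<le> 2 ^ n)"

lemma move_bounds:
  assumes "move a w c p q = (c', p', q', x)" "0 \<le> p" "0 \<le> q"
  shows "\<bar>c'\<bar> \<le> \<bar>c\<bar> + 1" "0 \<le> p'" "0 \<le> q'" "p' + q' = 2 * (p + q)" "0 \<le> x" "x \<le> 2 * (p + q)"
  using assms by (auto simp: move_def split: if_splits)

text \<open>The factor 2 matches the doubled weights. The five cases for \<open>c\<close> are the
  possible sign patterns of the leads \<open>c\<close> and \<open>c + 2\<close>.\<close>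

lemma move_value:
  assumes "move a w c p q = (c', p', q', x)" "0 \<le> a"
  shows "2 * (p * future ((a, b, w) # xs) c + q * future ((a, b, w) # xs) (c + 2)) =
    x * (a / b) + p' * future xs c' + q' * future xs (c' + 2)"
proof -
  consider "c > 0" | "c = 0" | "c = - 1" | "c = - 2" | "c < - 2" by linarith
  then show ?thesis
    using assms by cases (auto simp: move_def algebra_simps add_divide_distrib split: if_splits)
qed

lemma dp_value_step:
  assumes "dp_bounds n t s" "item_ok n y"
  shows "dp_value (y # xs) s = dp_value xs (dp_step y s)"
proof -
  obtain c p q B N where s: "s = (c, p, q, B, N)" by (cases s) auto
  obtain a b w where y: "y = (a, b, w)" by (cases y) auto
  obtain c' p' q' x where mv: "move a w c p q = (c', p', q', x)" by (cases "move a w c p q") auto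
  have pos: "p + q > 0" "B > 0" "b > 0" "a \<ge> 0" "p \<ge> 0" "q \<ge> 0"
    using assms by (auto simp: s y item_ok_def)
  define W where "W = real_of_int (p + q)"
  define F where "F = p * future ((a, b, w) # xs) c + q * future ((a, b, w) # xs) (c + 2)"
  define G where "G = p' * future xs c' + q' * future xs (c' + 2)"
  have W: "real_of_int (p' + q') = 2 * W" "W > 0"
    using move_bounds[OF mv pos(5,6)] pos(1) by (simp_all add: W_def)
  have eq: "2 * F = x * (a / b) + G"
    using move_value[OF mv pos(4), of b xs] by (simp add: F_def G_def)
  have "dp_value (y # xs) s = N / (W * B) + F / W"
    by (simp add: s y W_def F_def del: future.simps)
  also have "\<dots> = (2 * N * b + a * x * B) / (2 * W * (b * B)) + G / (2 * W)"
  proof -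
    have "F = (x * (a / b) + G) / 2" using eq by simp
    moreover have "(2 * N * b + a * x * B) / (2 * W * (b * B)) = N / (W * B) + x * (a / b) / (2 * W)"
      using pos W(2) by (simp add: field_simps)
    ultimately show ?thesis by (simp add: add_divide_distrib)
  qed
  also have "\<dots> = dp_value xs (dp_step y s)"
    unfolding s y dp_step.simps mv using W(1) by (simp add: G_def)
  finally show ?thesis .
qed

lemma dp_bounds_step:
  assumes "dp_bounds n t s" "item_ok n y"
  shows "dp_bounds n (Suc t) (dp_step y s)"
proof -
  obtain c p q B N where s: "s = (c, p, q, B, N)" by (cases s) auto
  obtain a b w where y: "y = (a, b, w)" by (cases y) auto
  obtain c' p' q' x where mv: "move a w c p q = (c', p', q', x)" by (cases "move a w c p q") auto
  have ab: "0 \<le> a" "a \<le> 2 ^ n" "0 < b" "b \<le> 2 ^ n" using assms by (auto simp: y item_ok_def)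
  have st: "0 \<le> p" "0 \<le> q" "p + q = 2 ^ t" "0 < B" "B \<le> 2 ^ (n * t)" "0 \<le> N"
    "N \<le> 2 ^ ((2 * n + 3) * t)" "\<bar>c\<bar> \<le> int t" using assms by (auto simp: s)
  note mb = move_bounds[OF mv st(1,2)]
  have x: "x \<le> 2 ^ (t + 1)" using mb(6) st(3) by simp
  have "b * B \<le> 2 ^ n * 2 ^ (n * t)" using ab st by (intro mult_mono) auto
  then have 1: "b * B \<le> 2 ^ (n * Suc t)" by (simp add: power_add)
  have "N * b \<le> 2 ^ ((2 * n + 3) * t) * 2 ^ n" using ab st by (intro mult_mono) auto
  also have "\<dots> \<le> 2 ^ ((2 * n + 3) * t + (n + 1))"
    unfolding power_add[symmetric] by (rule power_increasing) auto
  finally have 2: "N * b \<le> 2 ^ ((2 * n + 3) * t + (n + 1))" .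
  have "a * x * B \<le> 2 ^ n * 2 ^ (t + 1) * 2 ^ (n * t)"
    using ab st mb x by (intro mult_mono) auto
  also have "\<dots> \<le> 2 ^ ((2 * n + 3) * t + (n + 1))"
    unfolding power_add[symmetric] by (rule power_increasing) (auto simp: algebra_simps)
  finally have "a * x * B \<le> 2 ^ ((2 * n + 3) * t + (n + 1))" .
  moreover have "(0 :: int) \<le> 2 ^ ((2 * n + 3) * t + (n + 1))" by simp
  \<comment> \<open>The sum is at most 3 times the power and is rounded up to 4 times; the exponent
    has then grown by \<open>n + 3\<close>, within the \<open>2 * n + 3\<close> allowed for one
    item.\<close>
  ultimately have "2 * N * b + a * x * B \<le> 4 * 2 ^ ((2 * n + 3) * t + (n + 1))"
    using 2 mult.assoc[of 2 N b] by linarith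
  also have "\<dots> = 2 ^ ((2 * n + 3) * t + (n + 1) + 2)" by (simp add: power_add)
  also have "\<dots> \<le> 2 ^ ((2 * n + 3) * Suc t)"
    by (rule power_increasing) (auto simp: algebra_simps)
  finally have 3: "2 * N * b + a * x * B \<le> 2 ^ ((2 * n + 3) * Suc t)" .
  show ?thesis
    unfolding s y dp_step.simps mv using 1 3 mb st ab by (simp del: mult_Suc mult_Suc_right)
qed

lemma dp_run:
  assumes "\<forall>y \<in> set ys. item_ok n y" "dp_bounds n t s"
  shows "dp_bounds n (t + length ys) (fold dp_step ys s)"
    and "dp_value (ys @ xs) s = dp_value xs (fold dp_step ys s)"
  using assms
proof (induction ys arbitrary: t s)
  case (Cons y ys)
  {
    case 1
    then show ?case using Cons(1)[where t = "Suc t" and s = "dp_step y s"] dp_bounds_step[of n t s y] by simp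
  next
    case 2
    then show ?case using Cons(2)[where t = "Suc t" and s = "dp_step y s"] dp_bounds_step[of n t s y]
      dp_value_step[of n t s y "ys @ xs"] by simp
  }
qed simp_all

lemma dp_bounds_init: "dp_bounds n 0 dp_init"
  by (simp add: dp_init_def)

lemma future_eq_dp:
  assumes "\<forall>y \<in> set ys. item_ok n y" "fold dp_step ys dp_init = (c, p, q, B, N)"
  shows "future ys 0 = N / ((p + q) * B)"
  using dp_run(2)[OF assms(1) dp_bounds_init, of "[]"] assms(2) by (simp add: dp_init_def)

section \<open>The program\<close>

text \<open>The input fills the registers from 0 on, so it is first copied to the registers
  from \<open>5 * m + 78\<close> on, where \<open>m\<close> is the number of items. Register 0 holds the number 2 of agents
  and can be overwritten; registers 2 to 5 are moved one by one, and a loop moves the others.\<close>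

definition copy_start :: com where
  "copy_start = Block
     [Mul 0 0 0, Mul 0 0 0, Add 1 1 0, Add 0 1 1, Add 0 0 0, Add 0 0 1,
      Store 0 2, SetC 2 1, Add 0 0 2, Store 0 3, Add 0 0 2, Store 0 4, Add 0 0 2, Store 0 5,
      SetC 5 84, Sub 5 0 5, SetC 3 6, Add 0 0 2]"

definition copy_body :: com where
  "copy_body = Block [Load 4 3, Store 0 4, Add 0 0 2, Add 3 3 2, Sub 5 5 2]"

text \<open>The length \<open>5 * m + 5\<close> is that of the decision problem: 2 header numbers,
  \<open>4 * m\<close> for the utilities, \<open>m\<close> for the arrival order, 1 for the agent
  and 2 for the bound. In the exact problem the last two registers hold 0, so one copying program
  serves both.\<close>

definition copied :: "nat \<Rightarrow> memory \<Rightarrow> memory \<Rightarrow> bool" where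
  "copied m inp s \<longleftrightarrow> (\<forall>x. 2 \<le> x \<longrightarrow> x < 5 * m + 5 \<longrightarrow> s (5 * m + 78 + x) = inp x)"

text \<open>The limit for \<open>j\<close> is \<open>5 * m + 6\<close> and not
  \<open>5 * m + 5\<close> because \<open>j\<close> starts at 6 even for \<open>m = 0\<close>; the
  counter in register 5 is then -1 and the loop is skipped.\<close>

definition copy_inv :: "nat \<Rightarrow> memory \<Rightarrow> nat \<Rightarrow> memory \<Rightarrow> bool" where
  "copy_inv m inp M s \<longleftrightarrow> (\<exists>j. 6 \<le> j \<and> j \<le> 5 * m + 6 \<and>
     s 0 = int (5 * m + 78 + j) \<and> s 1 = int m + 16 \<and> s 2 = 1 \<and> s 3 = int j \<and>
     s 5 = 5 * int m + 5 - int j \<and>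
     (\<forall>x. 2 \<le> x \<longrightarrow> x < j \<longrightarrow> s (5 * m + 78 + x) = inp x) \<and>
     (\<forall>x. j \<le> x \<longrightarrow> x < 5 * m + 7 \<longrightarrow> s x = inp x)) \<and> bounded_mem M s"

text \<open>Registers 0 and 1 suffice to form the first target address: squaring the 2 in register 0
  twice gives 16, and \<open>5 * (m + 16)\<close> is \<open>5 * m + 80\<close>, the new place of
  input register 2. Hence the offset \<open>5 * m + 78\<close>, which lies beyond the input and the
  working registers.\<close>

lemma copy_start_effect:
  assumes "inp 0 = 2" "inp 1 = int m"
  shows "denote copy_start inp = inp(1 := int m + 16, 5 * m + 80 := inp 2, 2 := 1,
    5 * m + 81 := inp 3, 5 * m + 82 := inp 4, 5 * m + 83 := inp 5,
    5 := 5 * int m - 1, 3 := 6, 0 := 84 + 5 * int m)"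
proof -
  have nat: "nat (5 * int m + 80) = 5 * m + 80" "nat (81 + 5 * int m) = 5 * m + 81"
    "nat (82 + 5 * int m) = 5 * m + 82" "nat (83 + 5 * int m) = 5 * m + 83"
    by auto
  show ?thesis
    unfolding copy_start_def
    by (simp add: assms[unfolded One_nat_def] nat)
qed

lemma copy_inv_start:
  assumes "inp 0 = 2" "inp 1 = int m" "bounded_mem M inp" "10 * m + 200 \<le> M"
  shows "copy_inv m inp M (denote copy_start inp)"
proof -
  have "bounded_mem M (denote copy_start inp)"
    unfolding copy_start_effect[OF assms(1,2)]
    using assms(4) by (intro bounded_mem_upd assms(3) bounded_memD[OF assms(3)]
        bit_len_leI[where k = "5 * m + 84"]) auto
  moreover have "\<forall>x. 2 \<le> x \<longrightarrow> x < 6 \<longrightarrow> denote copy_start inp (5 * m + 78 + x) = inp x"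
  proof (intro allI impI)
    fix x :: nat assume "2 \<le> x" "x < 6"
    then have "x = 2 \<or> x = 3 \<or> x = 4 \<or> x = 5" by auto
    then show "denote copy_start inp (5 * m + 78 + x) = inp x"
      unfolding copy_start_effect[OF assms(1,2)] by auto
  qed
  moreover have "\<forall>x. 6 \<le> x \<longrightarrow> x < 5 * m + 7 \<longrightarrow> denote copy_start inp x = inp x"
    unfolding copy_start_effect[OF assms(1,2)] by auto
  ultimately show ?thesis
    unfolding copy_inv_def
    by (intro conjI exI[of _ 6]) (simp_all add: copy_start_effect[OF assms(1,2)])
qed

lemma copy_inv_step:
  assumes "copy_inv m inp M s" "s 5 > 0" "10 * m + 200 \<le> M"
  shows "copy_inv m inp M (denote copy_body s)" "denote copy_body s 5 = s 5 - 1"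
proof -
  from assms(1) obtain j where j: "6 \<le> j" "j \<le> 5 * m + 6"
     "s 0 = int (5 * m + 78 + j)" "s 1 = int m + 16" "s 2 = 1" "s 3 = int j"
     "s 5 = 5 * int m + 5 - int j"
     "\<And>x. 2 \<le> x \<Longrightarrow> x < j \<Longrightarrow> s (5 * m + 78 + x) = inp x"
     "\<And>x. j \<le> x \<Longrightarrow> x < 5 * m + 7 \<Longrightarrow> s x = inp x" and bd: "bounded_mem M s"
    unfolding copy_inv_def by blast
  have nat: "nat (s 0) = 5 * m + 78 + j" "nat (s 3) = j" using j by simp_all
  have jlt: "j < 5 * m + 5" using assms(2) j by simp
  have eff: "denote copy_body s = s(4 := s j, 5 * m + 78 + j := s j, 0 := int (5 * m + 79 + j),
      3 := int (j + 1), 5 := 5 * int m + 5 - int (j + 1))"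
    unfolding copy_body_def using j(1-7) nat by (simp add: fun_eq_iff)
  have "bounded_mem M (denote copy_body s)"
    unfolding eff
    using assms(3) jlt by (intro bounded_mem_upd bd bounded_memD[OF bd]
        bit_len_leI[where k = "10 * m + 90"]) auto
  moreover have "denote copy_body s (5 * m + 78 + x) = inp x" if "2 \<le> x" "x < j + 1" for x
    using that j(8)[of x] j(9)[of j] jlt j(1) unfolding eff by (cases "x = j") auto
  moreover have "denote copy_body s x = inp x" if "j + 1 \<le> x" "x < 5 * m + 7" for x
    using that j(9)[of x] j(1) unfolding eff by auto
  ultimately show "copy_inv m inp M (denote copy_body s)"
    unfolding copy_inv_def
    using j(1-7) jlt by (intro conjI exI[of _ "j + 1"]) (simp_all add: eff)
  show "denote copy_body s 5 = s 5 - 1" unfolding eff using j by simp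
qed

definition copy_input :: com where
  "copy_input = Seq copy_start (WhilePos 5 copy_body)"

lemma cost_le_square: "(M :: nat) \<ge> 1 \<Longrightarrow> x \<le> k * M \<Longrightarrow> x \<le> k * M * M"
  by (rule order.trans[of _ "k * M"]) simp_all

lemma copy_input_terminates:
  assumes "inp 0 = 2" "inp 1 = int m" "bounded_mem M inp" "10 * m + 200 \<le> M"
  shows "terminates copy_input inp ((cost_const copy_start + while_const 5 copy_body) * M * M)
      (\<lambda>s. s 1 = int m + 16 \<and> s 2 = 1 \<and> copied m inp s \<and> bounded_mem M s)"
proof (rule terminates_weaken)
  let ?s = "denote copy_start inp"
  have start: "loop_free copy_start" and body: "loop_free copy_body"
    by (simp_all add: copy_start_def copy_body_def)
  show "terminates copy_input inp
      (cost_const copy_start * M + while_const 5 copy_body * M * (nat (?s 5) + 1))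
      (\<lambda>s. copy_inv m inp M s \<and> \<not> s 5 > 0)"
    unfolding copy_input_def
  proof (rule terminates_Seq[OF loop_free_terminates[OF start assms(3), of "\<lambda>s. s = ?s"]])
    fix s assume s: "s = ?s"
    show "terminates (WhilePos 5 copy_body) s (while_const 5 copy_body * M * (nat (?s 5) + 1))
        (\<lambda>s. copy_inv m inp M s \<and> \<not> s 5 > 0)"
      unfolding s
    proof (rule while_terminates[OF body, of _ _ _ _ "\<lambda>s. nat (s 5)"])
      show "copy_inv m inp M ?s" by (rule copy_inv_start[OF assms])
      show "bounded_mem M s" if "copy_inv m inp M s" for s
        using that by (simp add: copy_inv_def)
      show "copy_inv m inp M (denote copy_body s)" if "copy_inv m inp M s" "s 5 > 0" for s
        using that assms(4) by (rule copy_inv_step)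
      show "nat (denote copy_body s 5) < nat (s 5)" if "copy_inv m inp M s" "s 5 > 0" for s
        using copy_inv_step(2)[OF that assms(4)] that(2) by simp
    qed
  qed (rule refl)
  show "cost_const copy_start * M + while_const 5 copy_body * M * (nat (?s 5) + 1) \<le>
      (cost_const copy_start + while_const 5 copy_body) * M * M"
  proof -
    have "nat (?s 5) + 1 \<le> M" using assms(4) by (simp add: copy_start_effect[OF assms(1,2)])
    then have "while_const 5 copy_body * M * (nat (?s 5) + 1) \<le> while_const 5 copy_body * M * M"
      by (rule mult_left_mono) simp
    then show ?thesis
      using cost_le_square[of M "cost_const copy_start * M" "cost_const copy_start"] assms(4)
      unfolding distrib_right by linarith
  qed
  show "s 1 = int m + 16 \<and> s 2 = 1 \<and> copied m inp s \<and> bounded_mem M s"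
    if fin: "copy_inv m inp M s \<and> \<not> s 5 > 0" for s
  proof -
    obtain j where "s 1 = int m + 16" "s 2 = 1" "s 5 = 5 * int m + 5 - int j"
      "\<And>x. 2 \<le> x \<Longrightarrow> x < j \<Longrightarrow> s (5 * m + 78 + x) = inp x" "bounded_mem M s"
      using fin unfolding copy_inv_def by blast
    moreover from this(3) fin have "5 * m + 5 \<le> j" by linarith
    ultimately show ?thesis unfolding copied_def by auto
  qed
qed

text \<open>Register 1 counts the remaining items, register 4 points to the next one, and registers
  6 and 7 to the utilities of the agent and of the other agent. The state
  \<open>(c, p, q, B, N)\<close> of the dynamic program is in registers 8 to 12.\<close>

definition main_start :: com where
  "main_start = Block
     [SetC 0 16, Sub 1 1 0, Add 3 1 1, Add 4 3 3, SetC 5 80, Add 5 5 1, Add 5 5 4, Add 4 4 5,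
      Add 6 4 1, Load 6 6, Mul 6 6 3, Sub 7 3 6, Add 6 6 5, Add 7 7 5,
      SetC 8 0, SetC 9 1, SetC 10 0, SetC 11 1, SetC 12 0]"

definition load_item :: com where
  "load_item = Block
     [Load 14 4, Add 14 14 14, Add 15 6 14, Load 16 15, Add 15 15 2, Load 17 15, Add 15 7 14,
      Load 18 15]"

definition own_move :: com where
  "own_move = Block [Add 8 8 2, Add 13 9 10, Add 13 13 13, Add 9 9 9, Add 10 10 10]"

definition other_move :: com where
  "other_move = Block [Sub 8 8 2, SetC 13 0, Add 9 9 9, Add 10 10 10]"

text \<open>Only positivity can be tested, so register 15 runs through \<open>c + 1\<close>,
  \<open>c + 2\<close>, \<open>c + 3\<close> to single out 0, -1 and -2. For \<open>c > 0\<close>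
  and \<open>c < -2\<close> both leads have the same sign, and the item goes to a fixed agent as if
  only that one had bid.\<close>

definition common_move :: com where
  "common_move =
     IfPos 8 other_move
       (Seq (Block [Add 15 8 2])
         (IfPos 15 (Block [Sub 8 8 2, Add 10 10 10, Add 10 10 9, SetC 13 0, Add 13 13 9])
           (Seq (Block [Add 15 15 2])
             (IfPos 15 (Block [Add 8 8 2, Add 13 9 9, Add 9 9 10, Add 9 9 9, SetC 10 0])
               (Seq (Block [Add 15 15 2])
                 (IfPos 15 (Block [Add 8 8 2, Add 9 9 9, Add 9 9 10, SetC 13 0, Add 13 13 9])
                   own_move))))))"

definition move_item :: com where
  "move_item =
     IfPos 16 (IfPos 18 common_move own_move)
       (IfPos 18 other_move (Block [SetC 13 0, Add 9 9 9, Add 10 10 10]))"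

text \<open>Clearing the scratch registers 13 to 18 restores their bound at the loop head without
  any estimate of what was left in them.\<close>

definition finish_item :: com where
  "finish_item = Block
     [Add 12 12 12, Mul 12 12 17, Mul 16 16 13, Mul 16 16 11, Add 12 12 16, Mul 11 17 11,
      Add 4 4 2, Sub 1 1 2, SetC 13 0, SetC 14 0, SetC 15 0, SetC 16 0, SetC 17 0, SetC 18 0]"

definition main_body :: com where
  "main_body = Seq load_item (Seq move_item finish_item)"

text \<open>As \<open>i\<close> is 0 or 1, subtracting \<open>2 * i * m\<close> from
  \<open>2 * m\<close> finds the utilities of the other agent without a branch. In the copy, the
  arrival order starts at \<open>9 * m + 80\<close> and the agent is at
  \<open>10 * m + 80\<close>.\<close>

lemma main_start_effect:
  assumes "s 1 = int m + 16" "s (10 * m + 80) = int i"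
  shows "denote main_start s = s(0 := 16, 1 := int m, 3 := 2 * int m, 5 := 5 * int m + 80,
    4 := 9 * int m + 80, 6 := 2 * int i * int m + 5 * int m + 80,
    7 := 2 * int m - 2 * int i * int m + 5 * int m + 80,
    8 := 0, 9 := 1, 10 := 0, 11 := 1, 12 := 0)"
proof -
  have nat: "nat (int m * 10 + 80) = m * 10 + 80" by auto
  have i: "s (m * 10 + 80) = int i" using assms(2) by (simp add: mult.commute)
  show ?thesis
    unfolding main_start_def
    by (simp add: assms(1)[unfolded One_nat_def] i nat algebra_simps)
qed

text \<open>Addresses above 18 lie beyond the working registers, so no write of this block alters a
  value still to be read.\<close>

lemma load_item_effect:
  assumes "s (nat (s 4)) = k" "nat (s 4) > 18" "s 2 = 1"
    "s (nat (s 6 + 2 * k)) = a" "nat (s 6 + 2 * k) > 18"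
    "s (nat (s 6 + 2 * k + 1)) = b" "nat (s 6 + 2 * k + 1) > 18"
    "s (nat (s 7 + 2 * k)) = w" "nat (s 7 + 2 * k) > 18"
  shows "denote load_item s = s(14 := 2 * k, 16 := a, 17 := b, 15 := s 7 + 2 * k, 18 := w)"
  unfolding load_item_def using assms by simp

lemma move_item_effect:
  assumes "move (s 16) (s 18) (s 8) (s 9) (s 10) = (c, p, q, x)" "s 2 = 1"
  shows "\<exists>z. denote move_item s = s(8 := c, 9 := p, 10 := q, 13 := x, 15 := z)"
proof -
  consider "s 8 > 0" | "s 8 = 0" | "s 8 = - 1" | "s 8 = - 2" | "s 8 < - 2" by linarith
  then have "denote move_item s =
      s(8 := c, 9 := p, 10 := q, 13 := x, 15 := denote move_item s 15)"
    using assms by cases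
      (auto simp: fun_eq_iff move_def move_item_def common_move_def own_move_def other_move_def
        split: if_splits)
  then show ?thesis ..
qed

lemma finish_item_effect:
  assumes "s 2 = 1"
  shows "denote finish_item s = s(12 := 2 * s 12 * s 17 + s 16 * s 13 * s 11,
    11 := s 17 * s 11, 4 := s 4 + 1, 1 := s 1 - 1,
    13 := 0, 14 := 0, 15 := 0, 16 := 0, 17 := 0, 18 := 0)"
  unfolding finish_item_def using assms by (simp add: fun_eq_iff)

lemma main_body_effect:
  assumes "s (nat (s 4)) = k" "nat (s 4) > 18" "s 2 = 1"
    "s (nat (s 6 + 2 * k)) = a" "nat (s 6 + 2 * k) > 18"
    "s (nat (s 6 + 2 * k + 1)) = b" "nat (s 6 + 2 * k + 1) > 18"
    "s (nat (s 7 + 2 * k)) = w" "nat (s 7 + 2 * k) > 18"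
    "dp_step (a, b, w) (s 8, s 9, s 10, s 11, s 12) = (c, p, q, B, N)"
  shows "denote main_body s = s(1 := s 1 - 1, 4 := s 4 + 1, 8 := c, 9 := p, 10 := q, 11 := B,
    12 := N, 13 := 0, 14 := 0, 15 := 0, 16 := 0, 17 := 0, 18 := 0)"
proof -
  let ?s = "denote load_item s"
  note load = load_item_effect[of s, OF assms(1-9)]
  obtain x where mv: "move a w (s 8) (s 9) (s 10) = (c, p, q, x)"
    and BN: "B = b * s 11" "N = 2 * s 12 * b + a * x * s 11"
    using assms(10) by (auto split: prod.splits)
  have "move (?s 16) (?s 18) (?s 8) (?s 9) (?s 10) = (c, p, q, x)" "?s 2 = 1"
    using mv assms(3) by (simp_all add: load)
  from move_item_effect[OF this] obtain z where
    z: "denote move_item ?s = ?s(8 := c, 9 := p, 10 := q, 13 := x, 15 := z)" ..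
  have "denote main_body s = denote finish_item (?s(8 := c, 9 := p, 10 := q, 13 := x, 15 := z))"
    by (simp add: main_body_def z)
  also have "\<dots> = s(1 := s 1 - 1, 4 := s 4 + 1, 8 := c, 9 := p, 10 := q, 11 := B,
      12 := N, 13 := 0, 14 := 0, 15 := 0, 16 := 0, 17 := 0, 18 := 0)"
    by (subst finish_item_effect) (simp_all add: assms(3) load BN fun_eq_iff)
  finally show ?thesis .
qed

section \<open>Memory layout, size bound and invariant of the main loop\<close>

definition encodes :: "memory \<Rightarrow> nat \<Rightarrow> nat \<Rightarrow> (nat \<Rightarrow> nat \<Rightarrow> rat) \<Rightarrow> nat list \<Rightarrow> nat \<Rightarrow> bool" where
  "encodes inp n m v ks i \<longleftrightarrow> inp 0 = 2 \<and> inp 1 = int m \<and> i < 2 \<and> length ks = m \<and>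
     (\<forall>j < 2. \<forall>k < m. inp (2 + 2 * (j * m + k)) = fst (quotient_of (v j k)) \<and>
        inp (3 + 2 * (j * m + k)) = snd (quotient_of (v j k)) \<and> v j k \<ge> 0) \<and>
     (\<forall>t < m. ks ! t < m \<and> inp (2 + 4 * m + t) = int (ks ! t)) \<and>
     inp (2 + 5 * m) = int i \<and> m \<le> n \<and> bounded_mem n inp"

text \<open>In \<open>encodes\<close>, \<open>n\<close> bounds both the number of items and the bit
  lengths of the input, so \<open>N\<close> ends with at most \<open>(2 * n + 3) * n + 2\<close>
  bits. The factor 200 leaves room for addresses, measured by their values.\<close>

definition size_bound :: "nat \<Rightarrow> nat" where
  "size_bound n = 200 * (n + 1) ^ 2"

lemma size_bound:
  assumes "m \<le> n"
  shows "10 * m + 200 \<le> size_bound n" "(2 * n + 3) * m + 3 \<le> size_bound n" "n \<le> size_bound n"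
proof -
  have "(2 * n + 3) * m \<le> (2 * n + 3) * n" using assms by (rule mult_left_mono) simp
  then show "10 * m + 200 \<le> size_bound n" "(2 * n + 3) * m + 3 \<le> size_bound n"
    "n \<le> size_bound n"
    using assms by (simp_all add: size_bound_def power2_eq_square algebra_simps)
qed

definition main_inv :: "memory \<Rightarrow> nat \<Rightarrow> nat \<Rightarrow> (nat \<Rightarrow> nat \<Rightarrow> rat) \<Rightarrow> nat list \<Rightarrow> nat \<Rightarrow>
    memory \<Rightarrow> bool" where
  "main_inv inp n m v ks i s \<longleftrightarrow> copied m inp s \<and> bounded_mem (size_bound n) s \<and> s 2 = 1 \<and>
     s 6 = int (2 * i * m + 5 * m + 80) \<and> s 7 = int (2 * (1 - i) * m + 5 * m + 80) \<and>
     (\<exists>t \<le> m. s 1 = int m - int t \<and> s 4 = int (9 * m + 80 + t) \<and>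
        (s 8, s 9, s 10, s 11, s 12) = fold dp_step (map (item v i) (take t ks)) dp_init)"

lemma item_ok_encodes:
  assumes "encodes inp n m v ks i" "t < m"
  shows "item_ok n (item v i (ks ! t))"
proof -
  let ?k = "ks ! t"
  have k: "?k < m" "i < 2" using assms by (auto simp: encodes_def)
  have le: "\<bar>inp j\<bar> \<le> 2 ^ n" for j
  proof -
    have "bit_len (inp j) \<le> n" using assms(1) by (simp add: encodes_def bounded_memD)
    have "\<bar>inp j\<bar> \<le> 2 ^ (bit_len (inp j) - 1)" using abs_less_bit_len[of "inp j"] by simp
    also have "(2 :: int) ^ (bit_len (inp j) - 1) \<le> 2 ^ n"
      using \<open>bit_len (inp j) \<le> n\<close> by (intro power_increasing) auto
    finally show ?thesis .
  qed
  have "v i ?k \<ge> 0" and a: "inp (2 + 2 * (i * m + ?k)) = fst (quotient_of (v i ?k))"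
    and b: "inp (3 + 2 * (i * m + ?k)) = snd (quotient_of (v i ?k))"
    using assms k by (auto simp: encodes_def)
  then have "fst (quotient_of (v i ?k)) \<ge> 0"
    using fst_quotient_of_pos_iff[of "v i ?k"]
    by (cases "v i ?k = 0") auto
  moreover have "snd (quotient_of (v i ?k)) > 0" by (rule quotient_of_denom_pos')
  ultimately show ?thesis
    using le[of "2 + 2 * (i * m + ?k)"] le[of "3 + 2 * (i * m + ?k)"]
    unfolding a b by (simp add: item_ok_def item_def)
qed

lemma dp_bounds_encodes:
  assumes "encodes inp n m v ks i" "t \<le> m"
  shows "dp_bounds n t (fold dp_step (map (item v i) (take t ks)) dp_init)"
proof -
  have "length ks = m" using assms by (simp add: encodes_def)
  then have "\<forall>y \<in> set (map (item v i) (take t ks)). item_ok n y"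
    using assms item_ok_encodes[OF assms(1)] by (auto simp: in_set_conv_nth)
  from dp_run(1)[OF this dp_bounds_init] show ?thesis
    using \<open>length ks = m\<close> assms(2) by simp
qed

lemma dp_bounds_bit_len:
  assumes "dp_bounds n t (c, p, q, B, N)" "t \<le> m" "m \<le> n"
  shows "bit_len c \<le> size_bound n" "bit_len p \<le> size_bound n" "bit_len q \<le> size_bound n"
    "bit_len B \<le> size_bound n" "bit_len N \<le> size_bound n"
proof -
  have b: "\<bar>c\<bar> \<le> int t" "0 \<le> p" "0 \<le> q" "p + q = 2 ^ t" "0 < B" "B \<le> 2 ^ (n * t)" "0 \<le> N"
    "N \<le> 2 ^ ((2 * n + 3) * t)" using assms(1) by auto
  have t: "(2 * n + 3) * t + 3 \<le> size_bound n" "10 * t + 200 \<le> size_bound n"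
    using size_bound[of t n] assms(2,3) by auto
  have nt: "n * t \<le> (2 * n + 3) * t" by simp
  have "bit_len c \<le> t + 2" using b by (intro bit_len_le_linear) auto
  then show "bit_len c \<le> size_bound n" using t by linarith
  have "bit_len p \<le> t + 2" "bit_len q \<le> t + 2"
    using b(2-4) by (intro bit_len_le_power; linarith)+
  then show "bit_len p \<le> size_bound n" "bit_len q \<le> size_bound n" using t by linarith+
  have "bit_len B \<le> n * t + 2" using b by (intro bit_len_le_power) auto
  then show "bit_len B \<le> size_bound n" using t nt by linarith
  have "bit_len N \<le> (2 * n + 3) * t + 2" using b by (intro bit_len_le_power) auto
  then show "bit_len N \<le> size_bound n" using t by linarith
qed

lemma main_inv_start:
  assumes "encodes inp n m v ks i" "s 1 = int m + 16" "s 2 = 1" "copied m inp s"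
    "bounded_mem (size_bound n) s"
  shows "main_inv inp n m v ks i (denote main_start s)"
proof -
  have i: "i < 2" "m \<le> n" and "inp (2 + 5 * m) = int i" using assms(1) by (auto simp: encodes_def)
  moreover have "s (5 * m + 78 + (2 + 5 * m)) = inp (2 + 5 * m)"
    using assms(4) unfolding copied_def by (elim allE[of _ "2 + 5 * m"]) simp
  ultimately have "s (5 * m + 78 + (2 + 5 * m)) = int i" by simp
  then have "s (10 * m + 80) = int i" by (simp add: algebra_simps)
  note eff = main_start_effect[OF assms(2) this]
  have i01: "i = 0 \<or> i = 1" using i by auto
  have "bounded_mem (size_bound n) (denote main_start s)"
    unfolding eff using size_bound(1)[OF i(2)] i01
    by (intro bounded_mem_upd assms(5) bit_len_leI[where k = "9 * m + 80"]) auto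
  moreover have "copied m inp (denote main_start s)"
    using assms(4) unfolding eff copied_def by simp
  ultimately show ?thesis
    unfolding main_inv_def using assms(3) i01
    by (intro conjI exI[of _ 0]) (auto simp: eff dp_init_def)
qed

lemma main_inv_step:
  assumes enc: "encodes inp n m v ks i" and inv: "main_inv inp n m v ks i s" and pos: "s 1 > 0"
  shows "main_inv inp n m v ks i (denote main_body s)" "denote main_body s 1 = s 1 - 1"
proof -
  have cp: "copied m inp s" and bd: "bounded_mem (size_bound n) s" and s2: "s 2 = 1"
    and s6: "s 6 = int (2 * i * m + 5 * m + 80)"
    and s7: "s 7 = int (2 * (1 - i) * m + 5 * m + 80)"
    using inv by (auto simp: main_inv_def)
  obtain t where t: "t \<le> m" "s 1 = int m - int t" "s 4 = int (9 * m + 80 + t)"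
    and st: "(s 8, s 9, s 10, s 11, s 12) = fold dp_step (map (item v i) (take t ks)) dp_init"
    using inv unfolding main_inv_def by blast
  have tm: "t < m" using t pos by linarith
  define k where "k = ks ! t"
  have i: "i < 2" and mn: "m \<le> n" and k: "k < m" and len: "length ks = m"
    and arr: "inp (2 + 4 * m + t) = int k"
    and util: "\<And>j. j < 2 \<Longrightarrow> inp (2 + 2 * (j * m + k)) = fst (quotient_of (v j k))"
      "\<And>j. j < 2 \<Longrightarrow> inp (3 + 2 * (j * m + k)) = snd (quotient_of (v j k))"
    using enc tm unfolding encodes_def k_def by auto
  have jmk: "j * m + k < 2 * m" if "j < 2" for j
  proof -
    have "j = 0 \<or> j = 1" using that by auto
    then show ?thesis using k by auto
  qed
  have other: "1 - i < 2" by arith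
  obtain c p q B N where step: "dp_step (item v i k) (s 8, s 9, s 10, s 11, s 12) = (c, p, q, B, N)"
    by (cases "dp_step (item v i k) (s 8, s 9, s 10, s 11, s 12)") auto
  have item: "item v i k = (fst (quotient_of (v i k)), snd (quotient_of (v i k)),
     fst (quotient_of (v (1 - i) k)))" by (simp add: item_def)
  \<comment> \<open>Addresses are rewritten as the offset of the copy plus an input index, the form
    to which \<open>copied\<close> applies.\<close>
  have n4: "nat (s 4) = 5 * m + 78 + (2 + 4 * m + t)" using t by simp
  have "s 6 + 2 * int k = int (5 * m + 78 + (2 + 2 * (i * m + k)))"
    "s 6 + 2 * int k + 1 = int (5 * m + 78 + (3 + 2 * (i * m + k)))"
    "s 7 + 2 * int k = int (5 * m + 78 + (2 + 2 * ((1 - i) * m + k)))"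
    unfolding s6 s7 by (simp_all add: algebra_simps)
  then have n6: "nat (s 6 + 2 * int k) = 5 * m + 78 + (2 + 2 * (i * m + k))"
    "nat (s 6 + 2 * int k + 1) = 5 * m + 78 + (3 + 2 * (i * m + k))"
    and n7: "nat (s 7 + 2 * int k) = 5 * m + 78 + (2 + 2 * ((1 - i) * m + k))"
    by (simp_all only: nat_int)
  have read: "s (5 * m + 78 + x) = inp x" if "2 \<le> x" "x < 5 * m + 5" for x
    using cp that by (simp add: copied_def)
  have eff: "denote main_body s = s(1 := s 1 - 1, 4 := s 4 + 1, 8 := c, 9 := p, 10 := q, 11 := B,
    12 := N, 13 := 0, 14 := 0, 15 := 0, 16 := 0, 17 := 0, 18 := 0)"
  proof (rule main_body_effect)
    show "s (nat (s 4)) = int k" unfolding n4 using tm arr by (subst read) auto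
    show "s (nat (s 6 + 2 * int k)) = fst (quotient_of (v i k))"
      unfolding n6 using jmk[OF i] util(1)[OF i] by (subst read) auto
    show "s (nat (s 6 + 2 * int k + 1)) = snd (quotient_of (v i k))"
      unfolding n6 using jmk[OF i] util(2)[OF i] by (subst read) auto
    show "s (nat (s 7 + 2 * int k)) = fst (quotient_of (v (1 - i) k))"
      unfolding n7 using jmk[OF other] util(1)[OF other] by (subst read) auto
  qed (use step item s2 n4 n6 n7 in auto)
  have take: "fold dp_step (map (item v i) (take (t + 1) ks)) dp_init = (c, p, q, B, N)"
    using tm len step by (simp add: take_Suc_conv_app_nth st[symmetric] k_def)
  have "dp_bounds n (t + 1) (c, p, q, B, N)"
    using dp_bounds_encodes[OF enc, of "t + 1"] tm unfolding take by simp
  note bits = dp_bounds_bit_len[OF this _ mn]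
  have "bounded_mem (size_bound n) (denote main_body s)"
    unfolding eff using bits tm t size_bound(1)[OF mn]
    by (intro bounded_mem_upd bd) (auto intro!: bit_len_leI[where k = "10 * m + 90"])
  moreover have "copied m inp (denote main_body s)"
    using cp unfolding eff copied_def by simp
  ultimately show "main_inv inp n m v ks i (denote main_body s)"
    unfolding main_inv_def using s2 s6 s7 tm t take
    by (intro conjI exI[of _ "t + 1"]) (auto simp: eff)
  show "denote main_body s 1 = s 1 - 1" by (simp add: eff)
qed

definition compute_utility :: com where
  "compute_utility = Seq copy_input (Seq main_start (WhilePos 1 main_body))"

definition utility_const :: nat where
  "utility_const = cost_const copy_start + while_const 5 copy_body + cost_const main_start +
     while_const 1 main_body"

lemma compute_utility_terminates:
  assumes enc: "encodes inp n m v ks i"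
  shows "terminates compute_utility inp (utility_const * size_bound n * size_bound n)
    (\<lambda>s. main_inv inp n m v ks i s \<and> s 1 = 0)"
proof (rule terminates_weaken)
  let ?M = "size_bound n"
  have mn: "m \<le> n" and inp: "inp 0 = 2" "inp 1 = int m" "bounded_mem n inp"
    using enc by (auto simp: encodes_def)
  have bd: "bounded_mem ?M inp" by (rule bounded_mem_mono[OF inp(3) size_bound(3)[OF le_refl]])
  have start: "loop_free main_start" and body: "loop_free main_body"
    by (simp_all add: main_start_def main_body_def load_item_def move_item_def common_move_def
        own_move_def other_move_def finish_item_def)
  show "terminates compute_utility inp ((cost_const copy_start + while_const 5 copy_body) * ?M * ?M +
      (cost_const main_start * ?M + while_const 1 main_body * ?M * ?M))
      (\<lambda>s. main_inv inp n m v ks i s \<and> \<not> s 1 > 0)"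
    unfolding compute_utility_def
  proof (rule terminates_Seq[OF copy_input_terminates[OF inp(1,2) bd size_bound(1)[OF mn]]])
    fix s assume s: "s 1 = int m + 16 \<and> s 2 = 1 \<and> copied m inp s \<and> bounded_mem ?M s"
    have inv: "main_inv inp n m v ks i (denote main_start s)"
      using main_inv_start[OF enc] s by blast
    show "terminates (Seq main_start (WhilePos 1 main_body)) s
        (cost_const main_start * ?M + while_const 1 main_body * ?M * ?M)
        (\<lambda>s. main_inv inp n m v ks i s \<and> \<not> s 1 > 0)"
    proof (rule terminates_Seq)
      show "terminates main_start s (cost_const main_start * ?M) (main_inv inp n m v ks i)"
        using s inv by (intro loop_free_terminates[OF start]) auto
    next
      fix s assume inv: "main_inv inp n m v ks i s"
      have "nat (s 1) + 1 \<le> ?M"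
      proof -
        obtain t where "s 1 = int m - int t" using inv by (auto simp: main_inv_def)
        then show ?thesis using size_bound(1)[OF mn] by simp
      qed
      then have le: "while_const 1 main_body * ?M * (nat (s 1) + 1) \<le>
          while_const 1 main_body * ?M * ?M"
        by (rule mult_left_mono) simp
      have "terminates (WhilePos 1 main_body) s (while_const 1 main_body * ?M * (nat (s 1) + 1))
          (\<lambda>s. main_inv inp n m v ks i s \<and> \<not> s 1 > 0)"
      proof (rule while_terminates[OF body, of _ _ _ _ "\<lambda>s. nat (s 1)"])
        show "main_inv inp n m v ks i s" by fact
        show "bounded_mem ?M s" if "main_inv inp n m v ks i s" for s
          using that by (simp add: main_inv_def)
        show "main_inv inp n m v ks i (denote main_body s)"
          if "main_inv inp n m v ks i s" "s 1 > 0" for s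
          using main_inv_step(1)[OF enc that] .
        show "nat (denote main_body s 1) < nat (s 1)"
          if "main_inv inp n m v ks i s" "s 1 > 0" for s
          using main_inv_step(2)[OF enc that] that(2) by simp
      qed
      then show "terminates (WhilePos 1 main_body) s (while_const 1 main_body * ?M * ?M)
          (\<lambda>s. main_inv inp n m v ks i s \<and> \<not> s 1 > 0)"
        using le by (rule terminates_weaken)
    qed
  qed
  have "?M \<ge> 1" using size_bound(1)[OF mn] by linarith
  from cost_le_square[OF this, of "cost_const main_start * ?M" "cost_const main_start"]
  show "(cost_const copy_start + while_const 5 copy_body) * ?M * ?M +
      (cost_const main_start * ?M + while_const 1 main_body * ?M * ?M) \<le> utility_const * ?M * ?M"
    unfolding utility_const_def distrib_right by linarith
  show "main_inv inp n m v ks i s \<and> s 1 = 0" if "main_inv inp n m v ks i s \<and> \<not> s 1 > 0" for s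
    using that by (auto simp: main_inv_def)
qed

section \<open>From the encoded input to the initial memory\<close>

lemma length_concat_pairs: "length (concat (map (\<lambda>k. [f k, g k]) [0..<m])) = 2 * m"
  by (induction m) simp_all

lemma nth_concat_pairs:
  assumes "k < m"
  shows "concat (map (\<lambda>k. [f k, g k]) [0..<m]) ! (2 * k) = f k"
    "concat (map (\<lambda>k. [f k, g k]) [0..<m]) ! Suc (2 * k) = g k"
  using assms by (induction m) (auto simp: nth_append length_concat_pairs less_Suc_eq)

lemma length_le_input_size: "length xs \<le> input_size xs"
proof (induction xs)
  case (Cons x xs)
  then show ?case using bit_len_pos[of x] by (simp add: input_size_def)
qed simp

lemma bounded_init_memory:
  assumes "xs \<noteq> []"
  shows "bounded_mem (input_size xs) (init_memory xs)"
proof -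
  have "bit_len (init_memory xs j) \<le> input_size xs" for j
  proof (cases "j < length xs")
    case True
    then have "bit_len (xs ! j) \<in> set (map bit_len xs)" by simp
    then have "bit_len (xs ! j) \<le> sum_list (map bit_len xs)" by (rule member_le_sum_list) simp
    then show ?thesis using True by (simp add: init_memory_def input_size_def)
  next
    case False
    have "1 \<le> input_size xs"
      using length_le_input_size[of xs] assms by (cases xs) auto
    then show ?thesis using False by (simp add: init_memory_def bit_len_def floorlog_def)
  qed
  then show ?thesis by (simp add: bounded_mem_def)
qed

text \<open>\<open>ys\<close> is what follows the agent in the input: nothing in the exact problem,
  the bound in the decision problem.\<close>

lemma encodes_enc_inst:
  assumes "valid_inst I" "num_agents I = 2" "i < 2" and xs: "xs = enc_inst I @ [int i] @ ys"
  shows "encodes (init_memory xs) (input_size xs) (num_items I) (utility I) (arrival I) i"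
    "\<And>j. j < length ys \<Longrightarrow> init_memory xs (3 + 5 * num_items I + j) = ys ! j"
proof -
  let ?m = "num_items I"
  define U where "U j = concat (map (\<lambda>k. [fst (quotient_of (utility I j k)),
    snd (quotient_of (utility I j k))]) [0..<?m])" for j
  have lenU: "length (U j) = 2 * ?m" for j by (simp add: U_def length_concat_pairs)
  have nthU: "U j ! (2 * k) = fst (quotient_of (utility I j k))"
    "U j ! Suc (2 * k) = snd (quotient_of (utility I j k))" if "k < ?m" for j k
    using nth_concat_pairs[OF that] by (simp_all add: U_def)
  have upt2: "[0..<2] = [0, 1 :: nat]" by (simp add: numeral_2_eq_2)
  have arr: "length (arrival I) = ?m"
    using assms(1) distinct_card[of "arrival I"] by (simp add: valid_inst_def)
  have xs: "xs = [2, int ?m] @ U 0 @ U 1 @ map int (arrival I) @ [int i] @ ys"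
    by (simp add: xs enc_inst_def assms(2) upt2 U_def enc_rat_def)
  have len: "length xs = 5 * ?m + 3 + length ys"
    by (simp add: xs lenU arr)
  have arrlt: "arrival I ! t < ?m" if "t < ?m" for t
    using that assms(1) arr nth_mem[of t "arrival I"] by (auto simp: valid_inst_def)
  have util: "init_memory xs (2 + 2 * (j * ?m + k)) = fst (quotient_of (utility I j k))"
    "init_memory xs (3 + 2 * (j * ?m + k)) = snd (quotient_of (utility I j k))"
    if "j < 2" "k < ?m" for j k
  proof -
    have "j = 0 \<or> j = 1" using that by auto
    then show "init_memory xs (2 + 2 * (j * ?m + k)) = fst (quotient_of (utility I j k))"
      "init_memory xs (3 + 2 * (j * ?m + k)) = snd (quotient_of (utility I j k))"
      using that(2) nthU[OF that(2)] unfolding init_memory_def len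
      by (auto simp: xs nth_append lenU arr numeral_3_eq_3)
  qed
  have time: "init_memory xs (2 + 4 * ?m + t) = int (arrival I ! t)" if "t < ?m" for t
    using that unfolding init_memory_def len by (simp add: xs nth_append lenU arr)
  have agent: "init_memory xs (2 + 5 * ?m) = int i"
    unfolding init_memory_def len by (simp add: xs nth_append lenU arr)
  have "init_memory xs 0 = 2" "init_memory xs 1 = int ?m" "xs \<noteq> []"
    by (simp_all add: init_memory_def xs)
  moreover have "?m \<le> input_size xs" using length_le_input_size[of xs] len by linarith
  ultimately show "encodes (init_memory xs) (input_size xs) ?m (utility I) (arrival I) i"
    unfolding encodes_def
    using assms arr arrlt util time agent bounded_init_memory[of xs] by (simp add: valid_inst_def)
  show "init_memory xs (3 + 5 * ?m + j) = ys ! j" if "j < length ys" for j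
    using that unfolding init_memory_def len
    by (simp add: xs nth_append lenU arr numeral_3_eq_3)
qed

text \<open>The last two facts serve the two continuations: \<open>s 12 + D\<close> is the first
  number given to Euclid's algorithm, and register 4 has come to point to the agent, just before the
  bound of the decision problem.\<close>

lemma main_inv_final:
  assumes enc: "encodes inp n m v ks i" and inv: "main_inv inp n m v ks i s" and "s 1 = 0"
  defines "D \<equiv> (s 9 + s 10) * s 11"
  shows "future (map (item v i) ks) 0 = s 12 / D" "D > 0" "s 12 \<ge> 0"
    "bit_len (s 12 + D) \<le> size_bound n" "s 4 = int (10 * m + 80)"
proof -
  obtain t where t: "t \<le> m" "s 1 = int m - int t" "s 4 = int (9 * m + 80 + t)"
    and st: "(s 8, s 9, s 10, s 11, s 12) = fold dp_step (map (item v i) (take t ks)) dp_init"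
    using inv unfolding main_inv_def by blast
  have tm: "t = m" using t assms(3) by simp
  have len: "length ks = m" and mn: "m \<le> n" using enc by (simp_all add: encodes_def)
  have st: "fold dp_step (map (item v i) ks) dp_init = (s 8, s 9, s 10, s 11, s 12)"
    using st tm len by simp
  have "dp_bounds n m (s 8, s 9, s 10, s 11, s 12)"
    using dp_bounds_encodes[OF enc le_refl] len st by simp
  then have b: "s 9 + s 10 = 2 ^ m" "0 < s 11" "s 11 \<le> 2 ^ (n * m)" "0 \<le> s 12"
    "s 12 \<le> 2 ^ ((2 * n + 3) * m)" by simp_all
  have "\<forall>y \<in> set (map (item v i) ks). item_ok n y"
    using item_ok_encodes[OF enc] len by (auto simp: in_set_conv_nth)
  from future_eq_dp[OF this st] show "future (map (item v i) ks) 0 = s 12 / D"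
    by (simp add: D_def)
  show D: "D > 0" "s 12 \<ge> 0" using b by (simp_all add: D_def)
  have "D \<le> 2 ^ m * 2 ^ (n * m)"
    unfolding D_def b(1) using b(3) by (rule mult_left_mono) simp
  also have "\<dots> \<le> 2 ^ ((2 * n + 3) * m)"
    unfolding power_add[symmetric] by (rule power_increasing) (auto simp: algebra_simps)
  finally have "\<bar>s 12 + D\<bar> \<le> 2 ^ ((2 * n + 3) * m + 1)" using b D by simp
  from bit_len_le_power[OF this] show "bit_len (s 12 + D) \<le> size_bound n"
    using size_bound(2)[OF mn] by linarith
  show "s 4 = int (10 * m + 80)" using t tm by simp
qed

section \<open>Computing the exact utility\<close>

text \<open>Clearing a register and adding another to it stands in for a copy instruction, here and
  in \<open>gcd_body\<close>.\<close>

definition gcd_start :: com where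
  "gcd_start = Block [Add 9 9 10, Mul 9 9 11, Add 0 12 9, SetC 3 0, Add 3 3 9]"

definition gcd_body :: com where
  "gcd_body = Block [Div 5 0 3, Mul 5 5 3, Sub 5 0 5, SetC 0 0, Add 0 0 3, SetC 3 0, Add 3 3 5]"

text \<open>The denominator comes first, since writing the numerator to register 0 destroys the gcd
  held there.\<close>

definition gcd_finish :: com where
  "gcd_finish = Block [Div 1 9 0, Div 0 12 0]"

text \<open>Starting Euclid's algorithm from \<open>(N + D, D)\<close> rather than \<open>(N, D)\<close> keeps the first number
  the larger one, so that every division halves it.\<close>

definition gcd_inv :: "int \<Rightarrow> int \<Rightarrow> nat \<Rightarrow> memory \<Rightarrow> bool" where
  "gcd_inv N D M s \<longleftrightarrow> s 12 = N \<and> s 9 = D \<and> 0 \<le> s 3 \<and> s 3 \<le> s 0 \<and> 0 < s 0 \<and> s 0 \<le> N + D \<and>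
     gcd (s 0) (s 3) = gcd N D \<and> bounded_mem M s"

text \<open>Turns the halving in Euclid's algorithm into a strictly decreasing measure that is
  linear in the bit lengths.\<close>

lemma bit_len_half:
  assumes "0 \<le> r" "2 * r < x"
  shows "bit_len r < bit_len x"
proof -
  define e where "e = bit_len x - 1"
  have x: "x < 2 ^ e" using abs_less_bit_len[of x] by (simp add: e_def)
  have "e \<noteq> 0"
  proof
    assume "e = 0"
    then show False using x assms by simp
  qed
  then obtain d where d: "e = Suc d" by (cases e) auto
  then have "\<bar>r\<bar> < 2 ^ d" using x assms by simp
  then have "bit_len r \<le> d + 1" unfolding bit_len_le_iff .
  then show ?thesis using d bit_len_pos[of x] by (simp add: e_def)
qed

lemma gcd_inv_step:
  assumes inv: "gcd_inv N D M s" and pos: "s 3 > 0" and M: "bit_len (N + D) \<le> M"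
  shows "gcd_inv N D M (denote gcd_body s)"
    "bit_len (denote gcd_body s 0) + bit_len (denote gcd_body s 3) < bit_len (s 0) + bit_len (s 3)"
proof -
  define x y where "x = s 0" and "y = s 3"
  have xy: "0 < y" "y \<le> x" "x \<le> N + D" "gcd x y = gcd N D" and bd: "bounded_mem M s"
    using inv pos by (auto simp: gcd_inv_def x_def y_def)
  have eff: "denote gcd_body s = s(5 := x mod y, 0 := y, 3 := x mod y)"
    by (simp add: gcd_body_def x_def y_def minus_div_mult_eq_mod fun_eq_iff)
  have r: "0 \<le> x mod y" "x mod y < y" using xy by simp_all
  \<comment> \<open>The invariant \<open>y \<le> x\<close> makes the quotient at least 1, so
    \<open>x\<close> is at least \<open>y\<close> plus the remainder, which is more than twice the
    remainder.\<close>
  have "1 \<le> x div y" using xy by (simp add: pos_imp_zdiv_pos_iff int_one_le_iff_zero_less)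
  then have "y * 1 \<le> y * (x div y)" using xy by (intro mult_left_mono) auto
  then have half: "2 * (x mod y) < x" using r mult_div_mod_eq[of y x] by linarith
  have "bounded_mem M (denote gcd_body s)"
    unfolding eff using xy r M
    by (intro bounded_mem_upd bd order.trans[OF bit_len_mono M]) auto
  moreover have "gcd y (x mod y) = gcd N D" using xy by (metis gcd.commute gcd_red_int)
  ultimately show "gcd_inv N D M (denote gcd_body s)"
    using inv xy r by (simp add: gcd_inv_def eff)
  show "bit_len (denote gcd_body s 0) + bit_len (denote gcd_body s 3) < bit_len (s 0) + bit_len (s 3)"
    using bit_len_half[OF r(1) half] by (simp add: eff x_def y_def)
qed

definition exact_program :: com where
  "exact_program = Seq compute_utility (Seq gcd_start (Seq (WhilePos 3 gcd_body) gcd_finish))"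

text \<open>The factor 3 comes from \<open>2 * M + 1 \<le> 3 * M\<close>, where \<open>2 * M\<close>
  bounds the sum of two bit lengths that counts the rounds of Euclid's algorithm.\<close>

definition exact_const :: nat where
  "exact_const = utility_const + cost_const gcd_start + 3 * while_const 3 gcd_body +
     cost_const gcd_finish"

lemma exact_program_terminates:
  assumes enc: "encodes inp n m v ks i"
  shows "terminates exact_program inp (exact_const * size_bound n * size_bound n)
    (\<lambda>s. \<exists>q. has_output s (enc_rat q) \<and> real_of_rat q = future (map (item v i) ks) 0)"
proof -
  let ?M = "size_bound n"
  let ?Q = "\<lambda>s. \<exists>q. has_output s (enc_rat q) \<and> real_of_rat q = future (map (item v i) ks) 0"
  have lf: "loop_free gcd_start" "loop_free gcd_body" "loop_free gcd_finish"
    by (simp_all add: gcd_start_def gcd_body_def gcd_finish_def)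
  have "m \<le> n" using enc by (simp add: encodes_def)
  then have M: "?M \<ge> 1" using size_bound(1)[of m n] by linarith
  have "terminates exact_program inp (utility_const * ?M * ?M + (cost_const gcd_start * ?M +
      (while_const 3 gcd_body * ?M * (2 * ?M + 1) + cost_const gcd_finish * ?M))) ?Q"
    unfolding exact_program_def
  proof (rule terminates_Seq[OF compute_utility_terminates[OF enc]])
    fix s assume s: "main_inv inp n m v ks i s \<and> s 1 = 0"
    define N D where "N = s 12" and "D = (s 9 + s 10) * s 11"
    have val: "future (map (item v i) ks) 0 = N / D" and D: "D > 0" "N \<ge> 0"
      and bits: "bit_len (N + D) \<le> ?M"
      using main_inv_final[OF enc] s unfolding N_def D_def by blast+
    have bd: "bounded_mem ?M s" using s by (simp add: main_inv_def)
    have eff: "denote gcd_start s = s(9 := D, 0 := N + D, 3 := D)"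
      by (simp add: gcd_start_def N_def D_def)
    have "bounded_mem ?M (denote gcd_start s)"
      unfolding eff using D
      by (intro bounded_mem_upd bd bits order.trans[OF bit_len_mono bits]) auto
    then have inv: "gcd_inv N D ?M (denote gcd_start s)"
      using D by (simp add: gcd_inv_def eff N_def)
    have fin: "?Q (denote gcd_finish s')" if s': "gcd_inv N D ?M s'" "\<not> s' 3 > 0" for s'
    proof (intro exI conjI)
      have "s' 3 = 0" using s' by (simp add: gcd_inv_def)
      then have g: "s' 0 = gcd N D" "s' 12 = N" "s' 9 = D" using s' by (auto simp: gcd_inv_def)
      \<comment> \<open>As \<open>D > 0\<close>, lowest terms arise by dividing out the gcd, with no
        change of sign.\<close>
      have "quotient_of (Fract N D) = (N div gcd N D, D div gcd N D)"
        using D by (simp add: quotient_of_Fract Rat.normalize_def Let_def)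
      then show "has_output (denote gcd_finish s') (enc_rat (Fract N D))"
        by (auto simp: has_output_def enc_rat_def gcd_finish_def g less_Suc_eq)
      show "real_of_rat (Fract N D) = future (map (item v i) ks) 0"
        using D by (simp add: of_rat_rat val)
    qed
    show "terminates (Seq gcd_start (Seq (WhilePos 3 gcd_body) gcd_finish)) s
      (cost_const gcd_start * ?M +
        (while_const 3 gcd_body * ?M * (2 * ?M + 1) + cost_const gcd_finish * ?M)) ?Q"
    proof (rule terminates_Seq)
      show "terminates gcd_start s (cost_const gcd_start * ?M) (gcd_inv N D ?M)"
        using bd inv by (intro loop_free_terminates[OF lf(1)]) auto
    next
      fix s assume inv: "gcd_inv N D ?M s"
      show "terminates (Seq (WhilePos 3 gcd_body) gcd_finish) s
        (while_const 3 gcd_body * ?M * (2 * ?M + 1) + cost_const gcd_finish * ?M) ?Q"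
      proof (rule terminates_Seq)
        have "bit_len (s 0) + bit_len (s 3) + 1 \<le> 2 * ?M + 1"
          using inv bounded_memD[of ?M s 0] bounded_memD[of ?M s 3] by (simp add: gcd_inv_def)
        then have le: "while_const 3 gcd_body * ?M * (bit_len (s 0) + bit_len (s 3) + 1) \<le>
            while_const 3 gcd_body * ?M * (2 * ?M + 1)"
          by (rule mult_left_mono) simp
        have "terminates (WhilePos 3 gcd_body) s
            (while_const 3 gcd_body * ?M * (bit_len (s 0) + bit_len (s 3) + 1))
            (\<lambda>s. gcd_inv N D ?M s \<and> \<not> s 3 > 0)"
        proof (rule while_terminates[OF lf(2), of _ _ _ _ "\<lambda>s. bit_len (s 0) + bit_len (s 3)"])
          show "gcd_inv N D ?M s" by fact
          show "bounded_mem ?M s" if "gcd_inv N D ?M s" for s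
            using that by (simp add: gcd_inv_def)
          show "gcd_inv N D ?M (denote gcd_body s)" if "gcd_inv N D ?M s" "s 3 > 0" for s
            using that bits by (rule gcd_inv_step(1))
          show "bit_len (denote gcd_body s 0) + bit_len (denote gcd_body s 3) <
              bit_len (s 0) + bit_len (s 3)" if "gcd_inv N D ?M s" "s 3 > 0" for s
            using that bits by (rule gcd_inv_step(2))
        qed
        then show "terminates (WhilePos 3 gcd_body) s (while_const 3 gcd_body * ?M * (2 * ?M + 1))
            (\<lambda>s. gcd_inv N D ?M s \<and> \<not> s 3 > 0)"
          using le by (rule terminates_weaken)
      next
        fix s assume s: "gcd_inv N D ?M s \<and> \<not> s 3 > 0"
        show "terminates gcd_finish s (cost_const gcd_finish * ?M) ?Q"
        proof (rule loop_free_terminates[OF lf(3)])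
          show "bounded_mem ?M s" using s by (simp add: gcd_inv_def)
          show "?Q (denote gcd_finish s)" using fin s by blast
        qed
      qed
    qed
  qed
  moreover have "utility_const * ?M * ?M + (cost_const gcd_start * ?M +
      (while_const 3 gcd_body * ?M * (2 * ?M + 1) + cost_const gcd_finish * ?M)) \<le>
      exact_const * ?M * ?M"
  proof -
    have "while_const 3 gcd_body * ?M * (2 * ?M + 1) \<le> while_const 3 gcd_body * ?M * (3 * ?M)"
      using M by (intro mult_left_mono) auto
    then have "while_const 3 gcd_body * ?M * (2 * ?M + 1) \<le> 3 * while_const 3 gcd_body * ?M * ?M"
      by (simp add: algebra_simps)
    then show ?thesis
      using cost_le_square[OF M, of "cost_const gcd_start * ?M" "cost_const gcd_start"]
        cost_le_square[OF M, of "cost_const gcd_finish * ?M" "cost_const gcd_finish"]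
      unfolding exact_const_def distrib_right by linarith
  qed
  ultimately show ?thesis by (rule terminates_weaken)
qed

section \<open>Deciding the necessary utility\<close>

text \<open>Cross-multiplication avoids reducing the fraction. Over the integers,
  \<open>a * D \<le> N * b\<close> is the same as \<open>N * b - a * D + 1 > 0\<close>, which suits
  the strict test of \<open>JumpPos\<close>.\<close>

definition compare_utility :: com where
  "compare_utility =
     Seq (Block [Add 9 9 10, Mul 9 9 11, Add 4 4 2, Load 0 4, Add 4 4 2, Load 3 4, Mul 3 3 12,
            Mul 0 0 9, Sub 3 3 0, Add 3 3 2])
       (IfPos 3 (Block [SetC 0 1]) (Block [SetC 0 0]))"

definition necessary_program :: com where
  "necessary_program = Seq compute_utility compare_utility"

definition necessary_const :: nat where
  "necessary_const = utility_const + cost_const compare_utility"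

lemma necessary_program_terminates:
  assumes enc: "encodes inp n m v ks i"
    and bound: "inp (3 + 5 * m) = fst (quotient_of r)" "inp (4 + 5 * m) = snd (quotient_of r)"
  shows "terminates necessary_program inp (necessary_const * size_bound n * size_bound n)
    (\<lambda>s. has_output s (enc_bool (real_of_rat r \<le> future (map (item v i) ks) 0)))"
proof -
  let ?M = "size_bound n"
  let ?Q = "\<lambda>s. has_output s (enc_bool (real_of_rat r \<le> future (map (item v i) ks) 0))"
  have lf: "loop_free compare_utility" by (simp add: compare_utility_def)
  have "m \<le> n" using enc by (simp add: encodes_def)
  then have M: "?M \<ge> 1" using size_bound(1)[of m n] by linarith
  have "terminates necessary_program inp
      (utility_const * ?M * ?M + cost_const compare_utility * ?M) ?Q"
    unfolding necessary_program_def
  proof (rule terminates_Seq[OF compute_utility_terminates[OF enc]])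
    fix s assume s: "main_inv inp n m v ks i s \<and> s 1 = 0"
    define N D a b where "N = s 12" and "D = (s 9 + s 10) * s 11"
      and "a = fst (quotient_of r)" and "b = snd (quotient_of r)"
    have val: "future (map (item v i) ks) 0 = N / D" and D: "D > 0"
      and s4: "s 4 = int (10 * m + 80)"
      using main_inv_final[OF enc] s unfolding N_def D_def by blast+
    have bd: "bounded_mem ?M s" and cp: "copied m inp s" and s2: "s 2 = 1"
      using s by (auto simp: main_inv_def)
    have b: "b > 0" unfolding b_def by (rule quotient_of_denom_pos')
    have "s (5 * m + 78 + (3 + 5 * m)) = inp (3 + 5 * m)"
      using cp unfolding copied_def by (elim allE[of _ "3 + 5 * m"]) simp
    moreover have "s (5 * m + 78 + (4 + 5 * m)) = inp (4 + 5 * m)"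
      using cp unfolding copied_def by (elim allE[of _ "4 + 5 * m"]) simp
    moreover have "s 4 + 1 = int (5 * m + 78 + (3 + 5 * m))"
      "s 4 + 2 = int (5 * m + 78 + (4 + 5 * m))" using s4 by simp_all
    ultimately have ab: "s (nat (s 4 + 1)) = a" "s (nat (s 4 + 2)) = b"
      by (simp_all only: nat_int bound a_def b_def)
    have far: "nat (s 4 + 1) > 12" "nat (s 4 + 2) > 12" "s 4 + 2 > 0" using s4 by simp_all
    have iff: "real_of_rat r \<le> N / D \<longleftrightarrow> N * b - a * D + 1 > 0"
    proof -
      have "real_of_rat r \<le> N / D \<longleftrightarrow> real_of_int a / real_of_int b \<le> N / D"
        by (simp add: real_of_rat_quotient a_def b_def)
      also have "\<dots> \<longleftrightarrow> real_of_int (a * D) \<le> real_of_int (N * b)"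
        using b D by (simp add: divide_simps mult.commute)
      also have "\<dots> \<longleftrightarrow> a * D \<le> N * b" by (rule of_int_le_iff)
      finally show ?thesis by linarith
    qed
    have "denote compare_utility s 0 = of_bool (N * b - a * D + 1 > 0)"
      using ab far s2 by (simp add: compare_utility_def N_def D_def mult.commute add.commute[of 2])
    then have "?Q (denote compare_utility s)"
      unfolding val iff by (simp add: has_output_def enc_bool_def)
    with bd show "terminates compare_utility s (cost_const compare_utility * ?M) ?Q"
      by (intro loop_free_terminates[OF lf]) auto
  qed
  moreover have "utility_const * ?M * ?M + cost_const compare_utility * ?M \<le>
      necessary_const * ?M * ?M"
    using cost_le_square[OF M, of "cost_const compare_utility * ?M" "cost_const compare_utility"]
    unfolding necessary_const_def distrib_right by linarith
  ultimately show ?thesis by (rule terminates_weaken)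
qed

text \<open>One factor \<open>size_bound n\<close> stems from the bit lengths and one from the
  number of rounds; both are quadratic, whence degree 4.\<close>

lemma size_bound_square: "K * size_bound n * size_bound n = 40000 * K * (n + 1) ^ 4"
proof -
  have "K * (200 * x ^ 2) * (200 * x ^ 2) = 40000 * K * x ^ 4" for x :: nat by algebra
  then show ?thesis unfolding size_bound_def .
qed

theorem theorem4:
  shows "poly_time_solvable enc_exact enc_rat
           {(I, i). valid_inst I \<and> num_agents I = 2 \<and> i < num_agents I}
           exact_utility \<and>
         poly_time_solvable enc_necessary enc_bool
           {(I, i, k). valid_inst I \<and> num_agents I = 2 \<and> i < num_agents I}
           necessary_utility"
proof
  show "poly_time_solvable enc_exact enc_rat
      {(I, i). valid_inst I \<and> num_agents I = 2 \<and> i < num_agents I} exact_utility"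
  proof (rule poly_time_solvableI)
    fix x assume "x \<in> {(I, i). valid_inst I \<and> num_agents I = 2 \<and> i < num_agents I}"
    then obtain I i where x: "x = (I, i)" and I: "valid_inst I" "num_agents I = 2" "i < 2"
      by auto
    let ?xs = "enc_exact x"
    have "?xs = enc_inst I @ [int i] @ []" by (simp add: x enc_exact_def)
    from exact_program_terminates[OF encodes_enc_inst(1)[OF I this]]
    obtain t s q where "exec exact_program (init_memory ?xs) t s"
      "t \<le> 40000 * exact_const * (input_size ?xs + 1) ^ 4" "has_output s (enc_rat q)"
      "real_of_rat q = expected_utility I i"
      unfolding terminates_def expected_utility_eq_future[OF I] size_bound_square by blast
    then show "\<exists>y t s. exec exact_program (init_memory ?xs) t s \<and>
        t \<le> 40000 * exact_const * (input_size ?xs + 1) ^ 4 \<and>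
        has_output s (enc_rat y) \<and> exact_utility x y"
      unfolding x exact_utility_def by auto
  qed
  show "poly_time_solvable enc_necessary enc_bool
      {(I, i, k). valid_inst I \<and> num_agents I = 2 \<and> i < num_agents I} necessary_utility"
  proof (rule poly_time_solvableI)
    fix x :: "alloc_inst \<times> nat \<times> rat"
    assume "x \<in> {(I, i, k). valid_inst I \<and> num_agents I = 2 \<and> i < num_agents I}"
    then obtain I i k where x: "x = (I, i, k)"
      and I: "valid_inst I" "num_agents I = 2" "i < 2" by auto
    let ?xs = "enc_necessary x"
    have xs: "?xs = enc_inst I @ [int i] @ enc_rat k" by (simp add: x enc_necessary_def)
    note enc = encodes_enc_inst[OF I xs]
    have "init_memory ?xs (3 + 5 * num_items I) = fst (quotient_of k)"
      "init_memory ?xs (4 + 5 * num_items I) = snd (quotient_of k)"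
      using enc(2)[of 0] enc(2)[of 1] by (simp_all add: enc_rat_def)
    from necessary_program_terminates[OF enc(1) this]
    obtain t s where "exec necessary_program (init_memory ?xs) t s"
      "t \<le> 40000 * necessary_const * (input_size ?xs + 1) ^ 4"
      "has_output s (enc_bool (real_of_rat k \<le> expected_utility I i))"
      unfolding terminates_def expected_utility_eq_future[OF I] size_bound_square by blast
    then show "\<exists>y t s. exec necessary_program (init_memory ?xs) t s \<and>
        t \<le> 40000 * necessary_const * (input_size ?xs + 1) ^ 4 \<and>
        has_output s (enc_bool y) \<and> necessary_utility x y"
      unfolding x necessary_utility_def by auto
  qed
qed

end
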